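(* Let $n\geq 2l\geq 0$ be integers. For each prime power $q$, let $T_0(q)\in M_n(\mathbb{F}_q)$ be any matrix with irreducible characteristic polynomial, and for $1\leq i\leq l$ let $T_i(q)=\begin{pmatrix}0&0\\0&T_i'(q)\end{pmatrix}\in M_n(\mathbb{F}_q)$, where the upper-left zero block has size $(n-l+i)\times(n-l+i)$ and $T_i'(q)$ is a nonsingular $(l-i)\times(l-i)$ matrix with irreducible characteristic polynomial (for $i=l$, $T_l(q)=0$). Define for $0\leq i,j\leq l$ \[ X_{ij}(q)=\begin{cases}\delta_{0j}+\delta_{nj}, & i=0,\\ \begin{bmatrix} n-l+i\\ j\end{bmatrix}_q+\begin{bmatrix} n-l+i\\ j-l+i\end{bmatrix}_q, & 1\leq i<l,\\ \begin{bmatrix} n\\ j\end{bmatrix}_q, & i=l,\end{cases} \] so that $X_{ij}(q)$ equals the number of $j$-dimensional $T_i(q)$-invariant subspaces of $\mathbb{F}_q^n$. Then the linear system \[ \alpha^{T_i(q)}_{nl}=\sum_{j=0}^l p_j(q)X_{ij}(q),\qquad 0\leq i\leq l, \] in the unknowns $p_0(q),\dots,p_l(q)$ has a unique solution, given by \[ p_j(q)=(-1)^j q^{\binom l2}\left(\begin{bmatrix} n-l-j\\ n-2l\end{bmatrix}_q q^{\binom{l-j+1}2}+\begin{bmatrix} n-l-j-1\\ n-2l\end{bmatrix}_q q^{\binom{l-j}2}\right). \]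
   Context: $\alpha^T_{nl}$ denotes the number of $l$-dimensional subspaces $W\subseteq\mathbb{F}_q^n$ with $\dim(W+TW)=2\dim W$ ($T$-anti-invariant subspaces). The $q$-binomial coefficient $\begin{bmatrix} a\\ b\end{bmatrix}_q$ is the number of $b$-dimensional subspaces of $\mathbb{F}_q^a$ for $a,b\geq 0$, and is taken to be $0$ when $b<0$ or $b>a$. The unknowns $p_j(q)$ are understood as functions of $q$ (polynomials/rational functions in $q$), the system being required for all prime powers $q$. *)

theory Defs
  imports "Jordan_Normal_Form.VS_Connect" "Jordan_Normal_Form.Char_Poly" "HOL-Library.Cardinality"
begin

text \<open>
  The finite field with \<open>q\<close> elements is an arbitrary type \<open>'a :: {field, finite}\<close> with
  \<open>CARD('a) = q\<close>; being free, this type ranges over all finite fields, hence over all prime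
  powers \<open>q\<close>. Functions of \<open>q\<close> are thereby treated one value at a time, so that uniqueness at
  each \<open>q\<close> covers arbitrary functions of \<open>q\<close>. The space of column vectors of length \<open>n\<close> is \<^term>\<open>module_vec TYPE('a::field) n\<close>.
\<close>

definition dim_of :: "nat \<Rightarrow> 'a::field vec set \<Rightarrow> nat" where
  "dim_of n W = vectorspace.dim class_ring (module_vec TYPE('a) n\<lparr>carrier := W\<rparr>)"

definition subspaces :: "nat \<Rightarrow> nat \<Rightarrow> 'a::field vec set set" where
  "subspaces n d = {W. VectorSpace.subspace class_ring W (module_vec TYPE('a) n) \<and> dim_of n W = d}"

text \<open>
  The \<open>q\<close>-binomial coefficient for \<open>q = CARD('a)\<close>. Its arguments are integers, since
  \<open>n - l - j - 1\<close> and \<open>j - l + i\<close> can be negative, where truncated subtraction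
  would give a different value.
\<close>

definition qbinom :: "'a::{field,finite} itself \<Rightarrow> int \<Rightarrow> int \<Rightarrow> nat" where
  "qbinom _ a b =
     (if 0 \<le> b \<and> b \<le> a then card (subspaces (nat a) (nat b) :: 'a vec set set) else 0)"

definition num_anti_invariant :: "nat \<Rightarrow> nat \<Rightarrow> 'a::{field,finite} mat \<Rightarrow> nat" where
  "num_anti_invariant n l T =
     card {W \<in> subspaces n l.
       dim_of n (module.submodule_sum (module_vec TYPE('a) n) W ((\<lambda>w. T *\<^sub>v w) ` W))
         = 2 * dim_of n W}"

definition num_invariant :: "nat \<Rightarrow> nat \<Rightarrow> 'a::{field,finite} mat \<Rightarrow> nat" where
  "num_invariant n j T = card {W \<in> subspaces n j. (\<lambda>w. T *\<^sub>v w) ` W \<subseteq> W}"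

text \<open>When \<open>l = 0\<close>, the cases \<open>i = 0\<close> and \<open>i = l\<close> overlap, and the first one is taken.\<close>

definition X_coeff :: "'a::{field,finite} itself \<Rightarrow> nat \<Rightarrow> nat \<Rightarrow> nat \<Rightarrow> nat \<Rightarrow> nat" where
  "X_coeff F n l i j =
     (if i = 0 then of_bool (j = 0) + of_bool (j = n)
      else if i < l then
        qbinom F (int n - int l + int i) (int j) +
        qbinom F (int n - int l + int i) (int j - int l + int i)
      else qbinom F (int n) (int j))"

end

theory Submission
  imports Defs "HOL-Library.Function_Algebras"
begin

text \<open>
  Write \<open>H(m, l)\<close> for the alternating sum of \<open>[d + k; d] [m; l - k] q ^ (k + 1 choose 2)\<close> over \<open>k \<le> l\<close>.
  The \<open>q\<close>-binomial theorem, applied to the polynomial \<open>[d + k; d]\<close> in \<open>q ^ k\<close>, gives the reflection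
  \<open>H(m, l) = H(m, m - d - 1 - l)\<close>. It shows that the claimed solution satisfies the rows \<open>i \<ge> 1\<close>, whose
  left-hand sides vanish because \<open>T i\<close> has rank below \<open>l\<close>; and, applied to the claimed solutions for all
  \<open>s \<le> l\<close> in place of \<open>l\<close>, it transforms the coefficient matrix into an antitriangular one.
  The row \<open>i = 0\<close> is the number of anti-invariant subspaces of an operator without
  proper invariant subspaces. It comes from counting the pairs \<open>U + T U \<subseteq> W\<close> in two ways, which determines
  recursively how many \<open>W\<close> have prescribed dimensions of \<open>W\<close> and of \<open>W \<inter> T\<^sup>-\<^sup>1 W\<close>;
  the \<open>q\<close>-Vandermonde identity verifies the closed form. For \<open>i \<ge> 1\<close>, the number of invariant
  subspaces is found from the fact that these are the subspaces that lie in the kernel or contain the image.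
\<close>

text \<open>
  The interpretations in \<open>VS_Connect\<close> declare these as simplification rules; they clash with
  \<open>power_Suc\<close> and with folding by \<open>sum.distrib\<close>.
\<close>

declare class_semiring.nat_pow_Suc [simp del]
  and class_semiring.add.finprod_multf [simp del]
  and class_cring.finprod_multf [simp del]

section \<open>Gaussian binomial coefficients\<close>

text \<open>The reflection has a simple cause: as a polynomial in \<open>q ^ k\<close>,
  \<open>[d + k; d]\<close> has degree \<open>d\<close> and vanishes at
  \<open>k = -1, ..., -d\<close>. A vanishing alternating sum over \<open>0, ..., m\<close>
  therefore falls into two copies of H, separated by a gap of \<open>d\<close> zero terms. The
  two-term shape of the claimed \<open>p_j\<close> turns a row into differences H(m, s) - H(m, s -
  1), which the reflection pairs off. Row 0 escapes this mechanism. Since \<open>j = n\<close> lies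
  outside the range of summation, the row reads off \<open>p_0\<close> alone, so its left-hand side
  has to be computed by geometry. The factored form that this yields also shows that the entry of
  the antitriangular matrix in row 0 is nonzero, where H says nothing. Dimension is measured by
  cardinality almost everywhere: a subspace with \<open>Q ^ d\<close> elements has dimension
  \<open>d\<close>, and the dimension formula becomes a count of fibres.\<close>

lemma choose_two_Suc: "Suc n choose 2 = (n choose 2) + n"
  by (simp add: numeral_2_eq_2)

lemma choose_two_add: "(m + n) choose 2 = (m choose 2) + (n choose 2) + m * n"
  by (induction m) (simp_all add: choose_two_Suc)

lemma twice_choose_two: "2 * (n choose 2) + n = n * n"
  by (induction n) (simp_all add: choose_two_Suc)

text \<open>Excluding 0 and roots of unity makes every q-factorial invertible, so Gaussian binomials
  can be quotients and their identities can be proved without subspaces.\<close>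

locale q_number =
  fixes q :: "'b::field"
  assumes q_nonzero: "q \<noteq> 0" and q_power_neq_1: "0 < k \<Longrightarrow> q ^ k \<noteq> 1"
begin

text \<open>This is \<open>(q - 1) ^ n\<close> times the usual q-factorial; the surplus powers
  cancel in \<open>gauss\<close>.\<close>

definition qfact :: "nat \<Rightarrow> 'b" where
  "qfact n = (\<Prod>i<n. q ^ Suc i - 1)"

definition gauss :: "nat \<Rightarrow> nat \<Rightarrow> 'b" where
  "gauss n k = (if k \<le> n then qfact n / (qfact k * qfact (n - k)) else 0)"

lemma qfact_0 [simp]: "qfact 0 = 1"
  by (simp add: qfact_def)

lemma qfact_Suc: "qfact (Suc n) = qfact n * (q ^ Suc n - 1)"
  by (simp add: qfact_def)

lemma qfact_nonzero [simp]: "qfact n \<noteq> 0"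
  using q_power_neq_1[of "Suc _"] by (simp add: qfact_def del: power_Suc)

lemma gauss_0 [simp]: "gauss n 0 = 1"
  by (simp add: gauss_def)

lemma gauss_self [simp]: "gauss n n = 1"
  by (simp add: gauss_def)

lemma gauss_eq_0: "n < k \<Longrightarrow> gauss n k = 0"
  by (simp add: gauss_def)

lemma gauss_sym: "k \<le> n \<Longrightarrow> gauss n (n - k) = gauss n k"
  by (simp add: gauss_def)

lemma gauss_absorb: "(q ^ Suc k - 1) * gauss (Suc n) (Suc k) = (q ^ Suc n - 1) * gauss n k"
  using q_power_neq_1[of "Suc k"] by (simp add: gauss_def qfact_Suc del: power_Suc)

lemma gauss_Suc: "gauss (Suc n) (Suc k) = gauss n k + q ^ Suc k * gauss n (Suc k)"
proof (cases "Suc k \<le> n")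
  case True
  then obtain m where m: "n = Suc (k + m)"
    using le_Suc_ex by (metis add_Suc)
  have nz: "q ^ Suc k - 1 \<noteq> 0" "q ^ Suc m - 1 \<noteq> 0"
    using q_power_neq_1 by (simp_all del: power_Suc)
  have [simp]: "Suc n - Suc k = Suc m" "n - k = Suc m" "n - Suc k = m"
    using m by auto
  have e: "q ^ Suc n - 1 = (q ^ Suc k - 1) + q ^ Suc k * (q ^ Suc m - 1)"
    by (simp add: m power_add algebra_simps)
  have "gauss (Suc n) (Suc k) =
      qfact n * (q ^ Suc n - 1) / (qfact k * (q ^ Suc k - 1) * (qfact m * (q ^ Suc m - 1)))"
    using True by (simp add: gauss_def qfact_Suc del: power_Suc)
  also have "\<dots> = qfact n / (qfact k * (qfact m * (q ^ Suc m - 1)))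
      + q ^ Suc k * (qfact n / (qfact k * (q ^ Suc k - 1) * qfact m))"
    unfolding e using nz by (simp add: divide_simps del: power_Suc) (simp add: algebra_simps)
  finally show ?thesis
    using True by (simp add: gauss_def qfact_Suc del: power_Suc)
qed (auto simp: gauss_def not_le less_Suc_eq)

lemma gauss_Suc': "k \<le> n \<Longrightarrow> gauss (Suc n) (Suc k) = q ^ (n - k) * gauss n k + gauss n (Suc k)"
proof (cases "k < n")
  case True
  then have "gauss (Suc n) (Suc k) = gauss (Suc n) (Suc (n - Suc k))"
    using gauss_sym[of "Suc k" "Suc n"] by (simp add: Suc_diff_Suc)
  also have "\<dots> = gauss n (n - Suc k) + q ^ (n - k) * gauss n (n - k)"
    using True gauss_Suc[of n "n - Suc k"] by (simp add: Suc_diff_Suc del: power_Suc)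
  finally show ?thesis
    using True by (simp add: gauss_sym)
qed (simp add: gauss_eq_0)

text \<open>Both sides are the q-multinomial coefficient with parts \<open>k\<close>,
  \<open>b\<close> and \<open>a - k - b\<close>, and both vanish if
  \<open>k + b > a\<close>.\<close>

lemma gauss_mult_gauss_diff: "gauss a k * gauss (a - k) b = gauss a b * gauss (a - b) k"
  by (cases "k + b \<le> a") (auto simp: gauss_def add.commute)

lemma gauss_mult_gauss:
  assumes "k \<le> m"
  shows "gauss n k * gauss (n - k) (m - k) = gauss n m * gauss m k"
  using assms by (cases "m \<le> n") (auto simp: gauss_def)

section \<open>The q-binomial theorem and the q-Vandermonde identity\<close>

theorem q_binomial: "(\<Prod>r<n. 1 + q ^ r * x) = (\<Sum>j\<le>n. q ^ (j choose 2) * gauss n j * x ^ j)"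
proof (induction n)
  case (Suc n)
  \<comment> \<open>The second Pascal rule fits here: its factor \<open>q ^ (n - j)\<close> turns
    the exponent \<open>(j choose 2) + j\<close> into \<open>(j choose 2) + n\<close>, as the new
    factor \<open>1 + q ^ n * x\<close> demands.\<close>
  have coeff: "q ^ (Suc j choose 2) * gauss (Suc n) (Suc j) * x ^ Suc j =
      q ^ (j choose 2) * gauss n j * x ^ j * (q ^ n * x)
      + q ^ (Suc j choose 2) * gauss n (Suc j) * x ^ Suc j" if "j \<le> n" for j
  proof -
    have "q ^ (Suc j choose 2) * q ^ (n - j) = q ^ (j choose 2) * q ^ n"
      using that by (simp add: choose_two_Suc flip: power_add)
    then show ?thesis
      by (simp add: gauss_Suc'[OF that] algebra_simps)
  qed
  have "(\<Sum>j\<le>Suc n. q ^ (j choose 2) * gauss (Suc n) j * x ^ j) =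
      1 + (\<Sum>j\<le>n. q ^ (Suc j choose 2) * gauss (Suc n) (Suc j) * x ^ Suc j)"
    by (subst sum.atMost_Suc_shift) (simp add: numeral_2_eq_2)
  also have "\<dots> = (\<Sum>j\<le>n. q ^ (j choose 2) * gauss n j * x ^ j * (q ^ n * x))
      + (1 + (\<Sum>j\<le>n. q ^ (Suc j choose 2) * gauss n (Suc j) * x ^ Suc j))"
    by (simp add: coeff sum.distrib del: power_Suc)
  also have "1 + (\<Sum>j\<le>n. q ^ (Suc j choose 2) * gauss n (Suc j) * x ^ Suc j) =
      (\<Sum>j\<le>Suc n. q ^ (j choose 2) * gauss n j * x ^ j)"
    by (subst sum.atMost_Suc_shift) (simp add: numeral_2_eq_2)
  also have "\<dots> = (\<Sum>j\<le>n. q ^ (j choose 2) * gauss n j * x ^ j)"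
    by (simp add: gauss_eq_0)
  finally show ?case
    by (simp only: prod.lessThan_Suc Suc sum_distrib_right) (simp add: distrib_left sum.distrib)
qed (simp add: numeral_2_eq_2)

text \<open>Reading \<open>gauss n j\<close> as \<open>gauss n (n - j)\<close> gives the usual
  convolution. Splitting \<open>gauss (Suc n)\<close> by the Pascal rule and recombining by the rule
  for \<open>gauss (Suc m)\<close> trades \<open>(m, s, Suc n)\<close> for
  \<open>(Suc m, Suc s, n)\<close>; hence \<open>m\<close> and \<open>s\<close> vary in the
  induction.\<close>

theorem q_vandermonde:
  "(\<Sum>j\<le>n. q ^ (j * (s + j)) * gauss m (s + j) * gauss n j) = gauss (m + n) (s + n)"
proof (induction n arbitrary: m s)
  case (Suc n)
  have G: "gauss (Suc n) (Suc j) = gauss n j + q ^ Suc j * gauss n (Suc j)" for j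
    by (rule gauss_Suc)
  have "(\<Sum>j\<le>Suc n. q ^ (j * (s + j)) * gauss m (s + j) * gauss (Suc n) j) =
     gauss m s + (\<Sum>j\<le>n. q ^ (Suc j * (s + Suc j)) * gauss m (s + Suc j) * gauss (Suc n) (Suc j))"
    by (subst sum.atMost_Suc_shift) simp
  also have "\<dots> = gauss m s
      + (\<Sum>j\<le>n. q ^ (Suc j * (s + Suc j)) * gauss m (s + Suc j) * q ^ Suc j * gauss n (Suc j))
      + (\<Sum>j\<le>n. q ^ (Suc j * (s + Suc j)) * gauss m (s + Suc j) * gauss n j)"
    unfolding G by (simp add: sum.distrib algebra_simps)
  also have "gauss m s
      + (\<Sum>j\<le>n. q ^ (Suc j * (s + Suc j)) * gauss m (s + Suc j) * q ^ Suc j * gauss n (Suc j)) =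
      (\<Sum>j\<le>Suc n. q ^ (j * (s + j)) * gauss m (s + j) * q ^ j * gauss n j)"
    by (subst sum.atMost_Suc_shift) simp
  also have "\<dots> = (\<Sum>j\<le>n. q ^ (j * (Suc s + j)) * gauss m (s + j) * gauss n j)"
    by (simp add: gauss_eq_0 power_add algebra_simps)
  also have "\<dots> + (\<Sum>j\<le>n. q ^ (Suc j * (s + Suc j)) * gauss m (s + Suc j) * gauss n j) =
      (\<Sum>j\<le>n. q ^ (j * (Suc s + j)) * gauss (Suc m) (Suc s + j) * gauss n j)"
    by (simp add: gauss_Suc power_add algebra_simps flip: sum.distrib)
  also have "\<dots> = gauss (m + Suc n) (s + Suc n)"
    unfolding Suc by simp
  finally show ?case .
qed simp

text \<open>The case \<open>s = 1\<close>. The summands vanish for \<open>j \<ge> m\<close> and for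
  \<open>j > r\<close>, so any bound \<open>K \<ge> m\<close> will do.\<close>

lemma q_vandermonde':
  assumes "m \<le> K"
  shows "(\<Sum>j<K. q ^ (j * Suc j) * gauss m (Suc j) * gauss r j) = gauss (m + r) (Suc r)"
proof -
  let ?t = "\<lambda>j. q ^ (j * Suc j) * gauss m (Suc j) * gauss r j"
  have "(\<Sum>j<K. ?t j) = (\<Sum>j<K + Suc r. ?t j)"
    using assms by (intro sum.mono_neutral_left) (auto simp: gauss_eq_0)
  also have "\<dots> = (\<Sum>j\<le>r. ?t j)"
    by (intro sum.mono_neutral_right) (auto simp: gauss_eq_0)
  also have "\<dots> = gauss (m + r) (Suc r)"
    using q_vandermonde[where n = r and s = 1 and m = m] by simp
  finally show ?thesis .
qed

section \<open>Vanishing alternating sums and the reflection identity\<close>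

text \<open>This is \<open>q_binomial\<close> at \<open>x = - 1 / q ^ s\<close>, a zero of the
  factor with \<open>r = s\<close>.\<close>

lemma alternating_gauss_sum_zero:
  assumes "s < n"
  shows "(\<Sum>j\<le>n. (-1) ^ j * q ^ (j choose 2) * gauss n j / q ^ (j * s)) = 0"
proof -
  have "(\<Prod>r<n. 1 + q ^ r * (- 1 / q ^ s)) = 0"
    using assms q_nonzero by (intro prod_zero bexI[of _ s]) auto
  moreover have "(- 1 / q ^ s) ^ j = (-1) ^ j / q ^ (j * s)" for j
    by (simp add: power_minus[of "1 / q ^ s"] power_one_over mult.commute flip: power_mult)
  ultimately show ?thesis
    unfolding q_binomial by (simp add: mult_ac)
qed

text \<open>The product is a polynomial of degree \<open>d\<close> in \<open>1 / q ^ j\<close>. Each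
  of its monomials only raises \<open>s\<close>, by at most \<open>d\<close>, and so contributes
  0.\<close>

lemma alternating_gauss_sum_poly_zero:
  assumes "s + d < n"
  shows "(\<Sum>j\<le>n. (-1) ^ j * q ^ (j choose 2) * gauss n j / q ^ (j * s)
           * (\<Prod>r<d. c r / q ^ j - 1)) = 0"
  using assms
proof (induction d arbitrary: s)
  case 0
  then show ?case
    by (simp add: alternating_gauss_sum_zero)
next
  case (Suc d)
  let ?t = "\<lambda>s j. (-1) ^ j * q ^ (j choose 2) * gauss n j / q ^ (j * s) * (\<Prod>r<d. c r / q ^ j - 1)"
  have "(-1) ^ j * q ^ (j choose 2) * gauss n j / q ^ (j * s) * (\<Prod>r<Suc d. c r / q ^ j - 1)
      = c d * ?t (Suc s) j - ?t s j" for j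
    using q_nonzero by (simp add: power_add field_simps)
  then have "(\<Sum>j\<le>n. (-1) ^ j * q ^ (j choose 2) * gauss n j / q ^ (j * s)
      * (\<Prod>r<Suc d. c r / q ^ j - 1)) = c d * (\<Sum>j\<le>n. ?t (Suc s) j) - (\<Sum>j\<le>n. ?t s j)"
    by (simp add: sum_subtractf sum_distrib_left)
  also have "\<dots> = 0"
    using Suc.IH[of "Suc s"] Suc.IH[of s] Suc.prems by simp
  finally show ?case .
qed

lemma prod_q_power_minus_1: "(\<Prod>r<d. q ^ (k + Suc r) - 1) = qfact (d + k) / qfact k"
  by (induction d) (simp_all add: qfact_Suc add_ac)

lemma prod_inverse_q_power_minus_1:
  "(\<Prod>r<d. 1 / q ^ (k + Suc r) - 1) = (-1) ^ d * (qfact (d + k) / qfact k) / q ^ (d * k + (Suc d choose 2))"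
proof (induction d)
  case (Suc d)
  have x: "1 / q ^ (k + Suc d) - 1 = - (q ^ (k + Suc d) - 1) / q ^ (k + Suc d)"
    using q_nonzero by (simp add: field_simps)
  have e: "q ^ (Suc d * k + (Suc (Suc d) choose 2)) = q ^ (d * k + (Suc d choose 2)) * q ^ (k + Suc d)"
    by (simp add: choose_two_Suc[of "Suc d"] add_ac flip: power_add)
  have f: "qfact (Suc d + k) = qfact (d + k) * (q ^ (k + Suc d) - 1)"
    by (simp add: qfact_Suc add.commute)
  show ?case
    unfolding prod.lessThan_Suc Suc x e f by (simp add: mult.assoc right_diff_distrib diff_divide_distrib)
qed (simp add: numeral_2_eq_2)

definition alt_sum :: "nat \<Rightarrow> nat \<Rightarrow> nat \<Rightarrow> 'b" where
  "alt_sum d m l = (\<Sum>k\<le>l. (-1) ^ k * q ^ (Suc k choose 2) * gauss (d + k) d * gauss m (l - k))"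

text \<open>The sum of all \<open>t j\<close> with \<open>j \<le> m\<close> is 0. At
  \<open>j = l - k\<close> the product in \<open>t\<close> is a multiple of
  \<open>gauss (d + k) d\<close>; it has zeros at \<open>j = l + 1, ..., l + d\<close>; and at
  \<open>j = l + Suc d + k\<close> it is again a multiple of \<open>gauss (d + k) d\<close>. The two
  nonzero stretches are the two sides.\<close>

lemma alt_sum_sym:
  assumes m: "m = Suc (d + l + i)"
  shows "alt_sum d m l = alt_sum d m i"
proof -
  define t where "t j = (-1) ^ j * q ^ (j choose 2) * gauss m j / q ^ (j * l)
      * (\<Prod>r<d. q ^ (l + Suc r) / q ^ j - 1)" for j
  \<comment> \<open>Normalised so that \<open>C * t l\<close> is \<open>gauss m l\<close>, the term
    \<open>k = 0\<close> of \<open>alt_sum d m l\<close>.\<close>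
  define C where "C = (-1) ^ l * q ^ (Suc l choose 2) / qfact d"
  define h where "h l k = (-1) ^ k * q ^ (Suc k choose 2) * gauss (d + k) d * gauss m (l - k)" for l k
  have sgn: "(-1) ^ (l - k) = (-1) ^ l * (-1 :: 'b) ^ k" if "k \<le> l" for k
    using that by (metis le_add_diff_inverse2 left_minus_one_mult_self mult.commute power_add)
  have low: "C * t (l - k) = h l k" if "k \<le> l" for k
  proof -
    have *: "q ^ (l + Suc r) / q ^ (l - k) = q ^ (k + Suc r)" for r
    proof -
      have "l + Suc r = (k + Suc r) + (l - k)" using that by simp
      then show ?thesis using q_nonzero by (simp only: power_add) simp
    qed
    have "qfact (d + k) / qfact k = qfact d * gauss (d + k) d"
      by (simp add: gauss_def)
    then have P: "(\<Prod>r<d. q ^ (l + Suc r) / q ^ (l - k) - 1) = qfact d * gauss (d + k) d"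
      unfolding * prod_q_power_minus_1 .
    have "((l - k) choose 2) + (Suc l choose 2) = (Suc k choose 2) + (l - k) * l"
    proof -
      from le_Suc_ex[OF that] obtain j where l: "l = k + j" ..
      then have "Suc l choose 2 = (Suc k choose 2) + (j choose 2) + Suc k * j"
        using choose_two_add[of "Suc k" j] by simp
      then show ?thesis
        using twice_choose_two[of j] l by (simp add: distrib_left mult.commute)
    qed
    then have e: "q ^ ((l - k) choose 2) * q ^ (Suc l choose 2) = q ^ (Suc k choose 2) * q ^ ((l - k) * l)"
      by (simp flip: power_add)
    have "C * t (l - k) = ((-1) ^ l * (-1) ^ l * (-1) ^ k) * (q ^ ((l - k) choose 2) * q ^ (Suc l choose 2))
        * gauss m (l - k) * gauss (d + k) d / q ^ ((l - k) * l)"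
      unfolding C_def t_def P sgn[OF that] by (simp add: mult_ac)
    also have "\<dots> = h l k"
      unfolding e h_def using q_nonzero by (simp add: mult_ac)
    finally show ?thesis .
  qed
  have mid: "t j = 0" if "l < j" "j \<le> l + d" for j
  proof -
    have "(\<Prod>r<d. q ^ (l + Suc r) / q ^ j - 1) = 0"
      using that q_nonzero by (intro prod_zero bexI[of _ "j - Suc l"]) auto
    then show ?thesis by (simp add: t_def)
  qed
  \<comment> \<open>The sign \<open>(-1) ^ d\<close> from inverting the \<open>d\<close> factors
    cancels against the length \<open>d\<close> of the gap. The extra \<open>Suc\<close> in the
    position leaves the minus sign that makes the vanishing sum an equality.\<close>
  have high: "C * t (l + Suc d + k) = - h i k" if "k \<le> i" for k
  proof -
    have "q ^ (l + Suc r) / q ^ (l + Suc d + k) = 1 / q ^ (k + Suc (d - Suc r))" if "r < d" for r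
    proof -
      have "l + Suc d + k = (l + Suc r) + (k + Suc (d - Suc r))" using that by simp
      then show ?thesis using q_nonzero by (simp only: power_add) simp
    qed
    then have "(\<Prod>r<d. q ^ (l + Suc r) / q ^ (l + Suc d + k) - 1) =
        (\<Prod>r<d. 1 / q ^ (k + Suc (d - Suc r)) - 1)"
      by (intro prod.cong) auto
    also have "\<dots> = (\<Prod>r<d. 1 / q ^ (k + Suc r) - 1)"
      by (rule prod.nat_diff_reindex)
    also have "\<dots> = (-1) ^ d * (qfact d * gauss (d + k) d) / q ^ (d * k + (Suc d choose 2))"
      unfolding prod_inverse_q_power_minus_1 by (simp add: gauss_def)
    finally have P: "(\<Prod>r<d. q ^ (l + Suc r) / q ^ (l + Suc d + k) - 1) =
      (-1) ^ d * (qfact d * gauss (d + k) d) / q ^ (d * k + (Suc d choose 2))" .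
    have "((l + Suc d + k) choose 2) + (Suc l choose 2) =
        (Suc k choose 2) + (l + Suc d + k) * l + (d * k + (Suc d choose 2))"
    proof -
      have "(l + Suc d + k) choose 2 = (l choose 2) + ((Suc d + k) choose 2) + l * (Suc d + k)"
        using choose_two_add[of l "Suc d + k"] by (simp add: add_ac)
      moreover have "(Suc d + k) choose 2 = (Suc d choose 2) + (k choose 2) + Suc d * k"
        by (rule choose_two_add)
      ultimately show ?thesis
        using twice_choose_two[of l] by (simp add: choose_two_Suc[of l] choose_two_Suc[of k] algebra_simps)
    qed
    then have e: "q ^ ((l + Suc d + k) choose 2) * q ^ (Suc l choose 2) =
        q ^ (Suc k choose 2) * q ^ ((l + Suc d + k) * l) * q ^ (d * k + (Suc d choose 2))"
      by (simp flip: power_add)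
    have s: "(-1) ^ l * (-1) ^ (l + Suc d + k) * (-1) ^ d = - ((-1 :: 'b) ^ k)"
      by (simp add: power_add)
    have g: "gauss m (l + Suc d + k) = gauss m (i - k)"
      using gauss_sym[of "i - k" m] that m by (simp add: add_ac)
    have "C * t (l + Suc d + k) = ((-1) ^ l * (-1) ^ (l + Suc d + k) * (-1) ^ d)
        * (q ^ ((l + Suc d + k) choose 2) * q ^ (Suc l choose 2)) * gauss m (i - k) * gauss (d + k) d
        / (q ^ ((l + Suc d + k) * l) * q ^ (d * k + (Suc d choose 2)))"
      unfolding C_def t_def P g by (simp add: mult_ac)
    also have "\<dots> = - h i k"
      unfolding e s h_def using q_nonzero by (simp add: mult_ac)
    finally show ?thesis .
  qed
  have "0 = C * (\<Sum>j\<le>m. t j)"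
    unfolding t_def using alternating_gauss_sum_poly_zero[of l d m "\<lambda>r. q ^ (l + Suc r)"] m by simp
  also have "(\<Sum>j\<le>m. t j) = (\<Sum>j\<le>l. t j) + (\<Sum>j\<in>{l + d<..m}. t j)"
  proof -
    have "(\<Sum>j\<le>m. t j) = (\<Sum>j\<in>{..l} \<union> {l + d<..m}. t j)"
      using m mid by (intro sum.mono_neutral_right) (auto, meson not_le)
    also have "\<dots> = (\<Sum>j\<le>l. t j) + (\<Sum>j\<in>{l + d<..m}. t j)"
      by (intro sum.union_disjoint) auto
    finally show ?thesis .
  qed
  also have "(\<Sum>j\<le>l. t j) = (\<Sum>k\<le>l. t (l - k))"
    by (rule sum.reindex_bij_witness[of _ "\<lambda>k. l - k" "\<lambda>k. l - k"]) auto
  also have "(\<Sum>j\<in>{l + d<..m}. t j) = (\<Sum>k\<le>i. t (l + Suc d + k))"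
    using m by (intro sum.reindex_bij_witness[of _ "\<lambda>k. l + Suc d + k" "\<lambda>j. j - (l + Suc d)"]) auto
  also have "C * ((\<Sum>k\<le>l. t (l - k)) + (\<Sum>k\<le>i. t (l + Suc d + k))) = alt_sum d m l - alt_sum d m i"
  proof -
    have "C * (\<Sum>k\<le>l. t (l - k)) = alt_sum d m l"
      by (simp add: sum_distrib_left low alt_sum_def flip: h_def)
    moreover have "C * (\<Sum>k\<le>i. t (l + Suc d + k)) = - alt_sum d m i"
      unfolding sum_distrib_left alt_sum_def sum_negf[symmetric] h_def[symmetric]
      by (intro sum.cong refl high) simp
    ultimately show ?thesis
      by (simp only: distrib_left) simp
  qed
  finally show ?thesis by simp
qed

text \<open>The product of binomials rearranges to \<open>gauss (d + l) d * gauss l k\<close>, and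
  the remaining sum is \<open>q_binomial\<close> at \<open>x = - q\<close>. Here \<open>m\<close> is
  too small for a reflection; these are the values that survive on the antidiagonal.\<close>

lemma alt_sum_top: "alt_sum d (d + l) l = gauss (d + l) d * (\<Prod>r<l. 1 - q ^ Suc r)"
proof -
  have "(-1) ^ k * q ^ (Suc k choose 2) * gauss (d + k) d * gauss (d + l) (l - k) =
      gauss (d + l) d * (q ^ (k choose 2) * gauss l k * (- q) ^ k)" if "k \<le> l" for k
  proof -
    have "gauss (d + l) (l - k) = gauss (d + l) (d + k)"
      using gauss_sym[of "d + k" "d + l"] that by simp
    moreover have "gauss (d + l) (d + k) * gauss (d + k) d = gauss (d + l) d * gauss l k"
      using gauss_mult_gauss[of d "d + k" "d + l"] by simp
    ultimately show ?thesis
      by (simp add: choose_two_Suc power_add power_minus[of q] mult_ac)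
  qed
  then have "alt_sum d (d + l) l = gauss (d + l) d * (\<Sum>k\<le>l. q ^ (k choose 2) * gauss l k * (- q) ^ k)"
    by (simp add: alt_sum_def sum_distrib_left)
  also have "(\<Sum>k\<le>l. q ^ (k choose 2) * gauss l k * (- q) ^ k) = (\<Prod>r<l. 1 - q ^ Suc r)"
    unfolding q_binomial[symmetric] by (simp add: mult.commute)
  finally show ?thesis .
qed

lemma alt_sum_top_nonzero: "alt_sum d (d + l) l \<noteq> 0"
proof -
  have "(\<Prod>r<l. 1 - q ^ Suc r) \<noteq> 0"
    using q_power_neq_1[of "Suc _"] by (force simp del: power_Suc)
  moreover have "gauss (d + l) d \<noteq> 0"
    by (simp add: gauss_def)
  ultimately show ?thesis
    unfolding alt_sum_top by simp
qed

section \<open>The bracket of the claimed solution\<close>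

text \<open>With \<open>d = n - 2 * l\<close> and \<open>k = l - j\<close> this is the bracket in
  the claimed \<open>p_j\<close>. For \<open>k = 0\<close> its second binomial is 0, whereas
  \<open>d + k - 1\<close> would truncate for \<open>d = 0\<close> and give 1.\<close>

definition sol_coeff :: "nat \<Rightarrow> nat \<Rightarrow> 'b" where
  "sol_coeff d k = q ^ (Suc k choose 2) * gauss (d + k) d
     + (if k = 0 then 0 else q ^ (k choose 2) * gauss (d + k - 1) d)"

text \<open>The second summand of \<open>sol_coeff\<close> at \<open>k\<close> is the first one at
  \<open>k - 1\<close>, so under the alternating sign it subtracts the sum for
  \<open>l - 1\<close>.\<close>

lemma sum_sol_coeff:
  "(\<Sum>k\<le>l. (-1) ^ k * sol_coeff d k * gauss m (l - k)) =
   alt_sum d m l - (if l = 0 then 0 else alt_sum d m (l - 1))"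
proof (cases l)
  case 0
  then show ?thesis by (simp add: sol_coeff_def alt_sum_def)
next
  case (Suc l')
  have "(\<Sum>k\<le>l. (-1) ^ k * (if k = 0 then 0 else q ^ (k choose 2) * gauss (d + k - 1) d) * gauss m (l - k))
    = - alt_sum d m l'"
    unfolding Suc alt_sum_def by (subst sum.atMost_Suc_shift) (simp add: sum_negf mult_ac)
  moreover have "(\<Sum>k\<le>l. (-1) ^ k * sol_coeff d k * gauss m (l - k)) =
     alt_sum d m l + (\<Sum>k\<le>l. (-1) ^ k * (if k = 0 then 0 else q ^ (k choose 2) * gauss (d + k - 1) d) * gauss m (l - k))"
    unfolding alt_sum_def sol_coeff_def by (simp add: algebra_simps flip: sum.distrib)
  ultimately show ?thesis
    using Suc by simp
qed

section \<open>The linear system\<close>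

lemma sol_coeff_0 [simp]: "sol_coeff d 0 = 1"
  by (simp add: sol_coeff_def numeral_2_eq_2)

text \<open>The right-hand side is that of \<open>num_core_eq\<close> at \<open>a = l\<close>,
  \<open>j = l - 1\<close>, with the factor \<open>gauss l l\<close> kept. The two summands of
  \<open>sol_coeff\<close> correspond to the splitting of \<open>q ^ n - 1\<close> into
  \<open>q ^ l * (q ^ (n - l) - 1)\<close> and \<open>q ^ l - 1\<close>.\<close>

lemma sol_coeff_top:
  assumes "0 < l" "2 * l \<le> n"
  shows "(q ^ l - 1) * (q ^ (l choose 2) * sol_coeff (n - 2 * l) l) =
    (q ^ n - 1) * q ^ ((l - 1) * l) * gauss l l * gauss (n - l - 1) (l - 1)"
proof -
  obtain l' where l': "l = Suc l'"
    using assms(1) by (cases l) auto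
  obtain m where m: "n - l = Suc m"
    using assms by (cases "n - l") auto
  let ?c = "q ^ (l choose 2)"
  have n: "q ^ n - 1 = q ^ l * (q ^ (n - l) - 1) + (q ^ l - 1)"
    using assms by (simp add: right_diff_distrib flip: power_add)
  have ix: "n - 2 * l + l = Suc m" "n - 2 * l = Suc m - l" "l \<le> Suc m" "n - 2 * l = m - l'" "l' \<le> m"
    using assms(2) m l' by linarith+
  have g: "gauss (n - 2 * l + l) (n - 2 * l) = gauss (Suc m) l"
      "gauss (n - 2 * l + l - 1) (n - 2 * l) = gauss m l'"
    using gauss_sym[OF ix(3)] gauss_sym[OF ix(5)] ix(1,2,4) by (simp_all only: diff_Suc_1)
  have Y: "(q ^ l - 1) * gauss (Suc m) l = (q ^ (n - l) - 1) * gauss m l'"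
    using gauss_absorb[of l' m] l' m by simp
  have e: "(l - 1) * l = (l choose 2) + (l choose 2)"
    using twice_choose_two[of l] l' by simp
  have ml: "n - l - 1 = m" "l - 1 = l'"
    using m l' by simp_all
  have S: "sol_coeff (n - 2 * l) l = ?c * q ^ l * gauss (Suc m) l + ?c * gauss m l'"
    unfolding sol_coeff_def g choose_two_Suc power_add using assms(1) by simp
  have "(q ^ l - 1) * (?c * sol_coeff (n - 2 * l) l) =
      ?c * ?c * (q ^ l * ((q ^ l - 1) * gauss (Suc m) l) + (q ^ l - 1) * gauss m l')"
    unfolding S by (simp add: algebra_simps)
  also have "\<dots> = (q ^ l * (q ^ (n - l) - 1) + (q ^ l - 1)) * (?c * ?c) * gauss m l'"
    unfolding Y by (simp add: algebra_simps)
  finally show ?thesis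
    unfolding n[symmetric] unfolding e power_add unfolding ml by simp
qed

lemma sol_coeff_top_nonzero:
  assumes "0 < l" "2 * l \<le> n"
  shows "sol_coeff (n - 2 * l) l \<noteq> 0"
proof -
  have "gauss (n - l - 1) (l - 1) \<noteq> 0"
    using assms by (simp add: gauss_def)
  then have "(q ^ n - 1) * q ^ ((l - 1) * l) * gauss l l * gauss (n - l - 1) (l - 1) \<noteq> 0"
    using assms q_nonzero q_power_neq_1[of n] by simp
  then show ?thesis
    unfolding sol_coeff_top[OF assms, symmetric] by auto
qed

section \<open>Triangularisation of the coefficient matrix\<close>

text \<open>The values of \<open>X_coeff\<close> for \<open>j \<le> l\<close>, \<open>0 < l\<close>
  and \<open>2 * l \<le> n\<close>. Then \<open>j < n\<close>, so row 0 keeps only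
  \<open>j = 0\<close>; the test \<open>l - i \<le> j\<close> stands for a nonnegative lower
  index.\<close>

definition coeff_matrix :: "nat \<Rightarrow> nat \<Rightarrow> nat \<Rightarrow> nat \<Rightarrow> 'b" where
  "coeff_matrix n l i j =
    (if i = 0 then of_bool (j = 0)
     else if i < l then gauss (n - l + i) j + (if l - i \<le> j then gauss (n - l + i) (j - (l - i)) else 0)
     else gauss n j)"

text \<open>Up to the factor \<open>q ^ (s choose 2)\<close>, this is the claimed solution for \<open>s\<close> in place of \<open>l\<close>.\<close>

definition sol :: "nat \<Rightarrow> nat \<Rightarrow> nat \<Rightarrow> 'b" where
  "sol n s j = (if j \<le> s then (-1) ^ j * sol_coeff (n - 2 * s) (s - j) else 0)"

text \<open>Both binomials of an inner row have this form, with \<open>e = 0\<close> and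
  \<open>e = l - i\<close>. Reversing the index by \<open>k = s - j\<close> leads to
  \<open>sum_sol_coeff\<close>.\<close>

lemma sum_sol_shift:
  assumes "s \<le> l" "e \<le> s"
  shows "(\<Sum>j\<le>l. sol n s j * (if e \<le> j then gauss m (j - e) else 0)) =
    (-1) ^ s * (alt_sum (n - 2 * s) m (s - e) - (if s = e then 0 else alt_sum (n - 2 * s) m (s - e - 1)))"
proof -
  have "(\<Sum>j\<le>l. sol n s j * (if e \<le> j then gauss m (j - e) else 0)) =
      (\<Sum>j\<in>{e..s}. sol n s j * (if e \<le> j then gauss m (j - e) else 0))"
    using assms by (intro sum.mono_neutral_right) (auto simp: sol_def)
  also have "\<dots> = (\<Sum>k\<le>s - e. sol n s (s - k) * gauss m (s - e - k))"
    using assms by (intro sum.reindex_bij_witness[of _ "\<lambda>k. s - k" "\<lambda>j. s - j"]) auto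
  also have "\<dots> = (\<Sum>k\<le>s - e. (-1) ^ s * ((-1) ^ k * sol_coeff (n - 2 * s) k * gauss m (s - e - k)))"
  proof (intro sum.cong refl)
    fix k assume "k \<in> {..s - e}"
    then have k: "k \<le> s" by simp
    then have "(-1 :: 'b) ^ (s - k) = (-1) ^ s * (-1) ^ k"
      by (metis le_add_diff_inverse2 left_minus_one_mult_self mult.commute power_add)
    then show "sol n s (s - k) * gauss m (s - e - k) =
        (-1) ^ s * ((-1) ^ k * sol_coeff (n - 2 * s) k * gauss m (s - e - k))"
      using k by (simp add: sol_def mult.assoc)
  qed
  also have "\<dots> = (-1) ^ s * (\<Sum>k\<le>s - e. (-1) ^ k * sol_coeff (n - 2 * s) k * gauss m (s - e - k))"
    by (rule sum_distrib_left[symmetric])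
  finally show ?thesis
    unfolding sum_sol_coeff using assms(2) by simp
qed

text \<open>Four values of \<open>alt_sum\<close> occur, at \<open>s\<close>, \<open>s - 1\<close>,
  \<open>s - (l - i)\<close> and \<open>s - (l - i) - 1\<close>. For \<open>m = n - l + i\<close>
  and \<open>d = n - 2 * s\<close> the reflection swaps indices with sum
  \<open>2 * s - (l - i) - 1\<close>, so the first cancels the last and the middle two cancel. At
  \<open>s = l - i\<close> the last index would be negative, and the value at \<open>s\<close> is
  left over.\<close>

lemma sum_sol_inner_row:
  assumes "0 < i" "i < l" "s \<le> l" "l - i \<le> s" "2 * l \<le> n"
  shows "(\<Sum>j\<le>l. sol n s j * coeff_matrix n l i j) =
    (if s = l - i then (-1) ^ s * alt_sum (n - 2 * s) (n - 2 * s + s) s else 0)"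
proof -
  let ?m = "n - l + i" and ?d = "n - 2 * s"
  let ?H = "alt_sum ?d ?m"
  have "(\<Sum>j\<le>l. sol n s j * coeff_matrix n l i j) =
      (\<Sum>j\<le>l. sol n s j * (if 0 \<le> j then gauss ?m (j - 0) else 0))
      + (\<Sum>j\<le>l. sol n s j * (if l - i \<le> j then gauss ?m (j - (l - i)) else 0))"
    using assms by (simp add: coeff_matrix_def distrib_left flip: sum.distrib)
  also have "\<dots> = (-1) ^ s * (?H s - ?H (s - 1) + (?H (s - (l - i)) - (if s = l - i then 0 else ?H (s - (l - i) - 1))))"
  proof -
    have "s \<noteq> 0"
      using assms by auto
    then show ?thesis
      unfolding sum_sol_shift[OF assms(3) le0] sum_sol_shift[OF assms(3,4)] by (simp add: distrib_left)
  qed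
  also have "?H (s - 1) = ?H (s - (l - i))"
    using assms by (intro alt_sum_sym) simp
  also have "?H s = ?H (s - (l - i) - 1)" if "s \<noteq> l - i"
    using assms that by (intro alt_sum_sym) simp
  then have "?H s - ?H (s - (l - i)) + (?H (s - (l - i)) - (if s = l - i then 0 else ?H (s - (l - i) - 1))) =
     (if s = l - i then ?H s else 0)"
    by simp
  also have "(-1) ^ s * (if s = l - i then ?H s else 0) =
      (if s = l - i then (-1) ^ s * alt_sum ?d (?d + s) s else 0)"
  proof -
    have "?m = ?d + s" if "s = l - i"
      using that assms by simp
    then show ?thesis by simp
  qed
  finally show ?thesis .
qed

text \<open>With \<open>m = n\<close> and \<open>d = n - 2 * s\<close> the reflection exchanges
  \<open>s\<close> and \<open>s - 1\<close>, so the only difference in this row vanishes.\<close>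

lemma sum_sol_last_row:
  assumes "0 < s" "s \<le> l" "2 * l \<le> n"
  shows "(\<Sum>j\<le>l. sol n s j * coeff_matrix n l l j) = 0"
proof -
  have "(\<Sum>j\<le>l. sol n s j * coeff_matrix n l l j) =
      (\<Sum>j\<le>l. sol n s j * (if 0 \<le> j then gauss n (j - 0) else 0))"
    using assms by (simp add: coeff_matrix_def)
  also have "\<dots> = (-1) ^ s * (alt_sum (n - 2 * s) n s - alt_sum (n - 2 * s) n (s - 1))"
    using assms sum_sol_shift[of s l 0 n n] by simp
  also have "alt_sum (n - 2 * s) n s = alt_sum (n - 2 * s) n (s - 1)"
    using assms by (intro alt_sum_sym) simp
  finally show ?thesis by simp
qed

lemma sum_first_row: "(\<Sum>j\<le>l. u j * coeff_matrix n l 0 j) = u 0"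
proof -
  have "(\<Sum>j\<le>l. u j * coeff_matrix n l 0 j) = (\<Sum>j\<in>{0}. u j * coeff_matrix n l 0 j)"
    by (intro sum.mono_neutral_right) (auto simp: coeff_matrix_def)
  then show ?thesis
    by (simp add: coeff_matrix_def)
qed

lemma sum_sol_zero:
  assumes "l - s < i" "i \<le> l" "s \<le> l" "2 * l \<le> n"
  shows "(\<Sum>j\<le>l. sol n s j * coeff_matrix n l i j) = 0"
  using assms sum_sol_inner_row[of i l s n] sum_sol_last_row[of s l n] by (cases "i = l") auto

text \<open>For \<open>s = l\<close> this is row 0, which reads off \<open>sol n l 0\<close>,
  nonzero by the factored form in \<open>sol_coeff_top\<close>. Every other entry is a value from
  \<open>alt_sum_top\<close>.\<close>

lemma sum_sol_antidiagonal_nonzero: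
  assumes "0 < s" "s \<le> l" "2 * l \<le> n"
  shows "(\<Sum>j\<le>l. sol n s j * coeff_matrix n l (l - s) j) \<noteq> 0"
proof (cases "s = l")
  case True
  then show ?thesis
    using sol_coeff_top_nonzero[OF assms(1), of n] assms by (simp add: sum_first_row sol_def)
next
  case False
  then have "(\<Sum>j\<le>l. sol n s j * coeff_matrix n l (l - s) j) =
      (-1) ^ s * alt_sum (n - 2 * s) (n - 2 * s + s) s"
    using assms sum_sol_inner_row[of "l - s" l s n] by simp
  then show ?thesis
    using alt_sum_top_nonzero by simp
qed

text \<open>The columns \<open>sol n s\<close> with \<open>s \<le> l\<close> form a triangular matrix \<open>P\<close> for which
  \<open>coeff_matrix n l \<cdot> P\<close> is antitriangular with nonzero antidiagonal.\<close>

theorem coeff_matrix_nonsingular: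
  assumes "0 < l" "2 * l \<le> n" "\<And>i. i \<le> l \<Longrightarrow> (\<Sum>j\<le>l. u j * coeff_matrix n l i j) = 0" "j \<le> l"
  shows "u j = 0"
proof -
  \<comment> \<open>Generalised for the induction: \<open>u\<close> is supported on the indices up
    to \<open>s\<close>, and only the last \<open>s + 1\<close> rows are used.\<close>
  have "u j = 0" if "s \<le> l" "\<And>j. s < j \<Longrightarrow> j \<le> l \<Longrightarrow> u j = 0"
    "\<And>i. l - s \<le> i \<Longrightarrow> i \<le> l \<Longrightarrow> (\<Sum>j\<le>l. u j * coeff_matrix n l i j) = 0" "j \<le> l" for u s j
    using that
  proof (induction s arbitrary: u j)
    case 0
    have "(\<Sum>j\<le>l. u j * coeff_matrix n l l j) = (\<Sum>j\<in>{0}. u j * coeff_matrix n l l j)"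
      using 0(2) by (intro sum.mono_neutral_right) auto
    then have "u 0 = 0"
      using 0(3)[of l] assms(1) by (simp add: coeff_matrix_def)
    then show ?case
      using 0 by (cases "j = 0") auto
  next
    case (Suc s)
    \<comment> \<open>\<open>sol n (Suc s) (Suc s)\<close> is \<open>(-1) ^ Suc s\<close>, its own
      inverse. Subtracting \<open>w\<close> times this column clears the entry \<open>Suc s\<close>
      of \<open>u\<close>, while the rows from \<open>l - s\<close> on still give 0; the row
      \<open>l - Suc s\<close> then forces \<open>w = 0\<close>.\<close>
    define w where "w = u (Suc s) * (-1) ^ Suc s"
    have top: "w * sol n (Suc s) (Suc s) = u (Suc s)"
      by (simp add: w_def sol_def mult.assoc flip: power_mult_distrib)
    have zero: "u j = w * sol n (Suc s) j" if "j \<le> l" for j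
    proof -
      have "u j - w * sol n (Suc s) j = 0"
      proof (rule Suc.IH)
        show "u j - w * sol n (Suc s) j = 0" if "s < j" "j \<le> l" for j
          using that top Suc.prems(2)[of j] by (cases "j = Suc s") (auto simp: sol_def)
        fix i assume i: "l - s \<le> i" "i \<le> l"
        have "(\<Sum>j\<le>l. (u j - w * sol n (Suc s) j) * coeff_matrix n l i j) =
            (\<Sum>j\<le>l. u j * coeff_matrix n l i j) - w * (\<Sum>j\<le>l. sol n (Suc s) j * coeff_matrix n l i j)"
          by (simp add: left_diff_distrib sum_subtractf sum_distrib_left mult.assoc)
        then show "(\<Sum>j\<le>l. (u j - w * sol n (Suc s) j) * coeff_matrix n l i j) = 0"
          using i Suc.prems(1) Suc.prems(3)[of i] sum_sol_zero[of l "Suc s" i n] assms(2) by simp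
      qed (use Suc.prems that in auto)
      then show ?thesis by simp
    qed
    have "w * (\<Sum>j\<le>l. sol n (Suc s) j * coeff_matrix n l (l - Suc s) j) =
        (\<Sum>j\<le>l. u j * coeff_matrix n l (l - Suc s) j)"
      using zero by (simp add: sum_distrib_left mult.assoc)
    also have "\<dots> = 0"
      by (rule Suc.prems(3)) auto
    finally have "w = 0"
      using sum_sol_antidiagonal_nonzero[of "Suc s" l n] Suc.prems(1) assms(2) by simp
    then show ?case
      using zero[OF Suc.prems(4)] by simp
  qed
  from this[of l u j] show ?thesis
    using assms by auto
qed

end

section \<open>Subspaces of finite vector spaces\<close>

lemma card_eq_sum_card_vimage:
  assumes "finite A" "finite B" "f ` A \<subseteq> B"
  shows "card A = (\<Sum>y\<in>B. card {x\<in>A. f x = y})"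
proof -
  have "card A = card (\<Union>y\<in>B. {x\<in>A. f x = y})"
    using assms(3) by (intro arg_cong[of _ _ card]) auto
  also have "\<dots> = (\<Sum>y\<in>B. card {x\<in>A. f x = y})"
    using assms by (intro card_UN_disjoint) auto
  finally show ?thesis .
qed

lemma card_Collect_swap:
  assumes "finite A" "finite B"
  shows "(\<Sum>x\<in>A. card {y\<in>B. P x y}) = (\<Sum>y\<in>B. card {x\<in>A. P x y})"
proof -
  have c: "card {z\<in>C. R z} = (\<Sum>z\<in>C. if R z then 1 else 0)" if "finite C" for C :: "'c set" and R
    using that by (simp add: sum.If_cases Int_def)
  show ?thesis
    unfolding c[OF assms(2)] using assms(1) by (subst sum.swap) (simp add: sum.If_cases Int_def)
qed

locale finite_field_vector_space = vector_space scale
  for scale :: "'a::{field,finite} \<Rightarrow> 'v::ab_group_add \<Rightarrow> 'v" (infixr "*s" 75) +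
  fixes Q :: nat
  assumes Q_def: "Q = CARD('a)"
begin

lemma two_le_card: "2 \<le> Q"
proof -
  have "card {0, 1 :: 'a} \<le> Q"
    unfolding Q_def by (intro card_mono) auto
  then show ?thesis by simp
qed

lemma card_power_inject [simp]: "Q ^ a = Q ^ b \<longleftrightarrow> a = b"
  using two_le_card by (simp add: power_inject_exp)

lemma card_power_le_iff: "Q ^ a \<le> Q ^ b \<longleftrightarrow> a \<le> b"
  using two_le_card by (intro power_increasing_iff) simp

lemma card_pos [simp]: "0 < Q"
  using two_le_card by simp

text \<open>Dimension is encoded by cardinality; as \<open>Q \<ge> 2\<close>, the exponent is
  unique. This makes sense for finite subspaces of an infinite space as well.\<close>

definition grass :: "nat \<Rightarrow> 'v set \<Rightarrow> 'v set set" where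
  "grass d E = {W. subspace W \<and> W \<subseteq> E \<and> card W = Q ^ d}"

definition ssum :: "'v set \<Rightarrow> 'v set \<Rightarrow> 'v set" where
  "ssum U V = {u + v | u v. u \<in> U \<and> v \<in> V}"

lemma finite_grass [simp]: "finite E \<Longrightarrow> finite (grass d E)"
  unfolding grass_def by (rule finite_subset[of _ "Pow E"]) auto

text \<open>A new independent vector \<open>b\<close> multiplies the size by \<open>Q\<close>: pairs
  of a scalar and an element of the old span correspond to elements of the new one.\<close>

lemma card_span_independent:
  assumes "finite B" "independent B"
  shows "finite (span B) \<and> card (span B) = Q ^ card B"
  using assms
proof (induction B)
  case (insert b B)
  have ind: "independent B" and b: "b \<notin> span B"
    using insert.prems insert.hyps by (auto simp: independent_insert)
  have fin: "finite (span B)" and card: "card (span B) = Q ^ card B"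
    using insert.IH ind by auto
  let ?f = "\<lambda>(c :: 'a, x). c *s b + x"
  have "inj_on ?f (UNIV \<times> span B)"
  proof (rule inj_onI, clarify)
    fix c x c' x' assume x: "x \<in> span B" "x' \<in> span B" and eq: "c *s b + x = c' *s b + x'"
    have "(c - c') *s b = x' - x"
      using eq by (simp add: scale_left_diff_distrib algebra_simps)
    then have "(c - c') *s b \<in> span B"
      using x by (simp add: span_diff)
    then have "c = c'"
      using b span_scale[of "(c - c') *s b" B "inverse (c - c')"] by (cases "c = c'") auto
    then show "c = c' \<and> x = x'"
      using eq by simp
  qed
  moreover have "?f ` (UNIV \<times> span B) = span (insert b B)"
  proof (intro equalityI subsetI)
    fix y assume "y \<in> ?f ` (UNIV \<times> span B)"
    then obtain c x where "x \<in> span B" "y = c *s b + x"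
      by auto
    then show "y \<in> span (insert b B)"
      by (metis span_add span_base span_scale insertI1 span_mono subset_insertI subsetD)
  next
    fix y assume "y \<in> span (insert b B)"
    then obtain c where "y - c *s b \<in> span B"
      by (auto simp: span_insert)
    then show "y \<in> ?f ` (UNIV \<times> span B)"
      by (intro image_eqI[of _ _ "(c, y - c *s b)"]) auto
  qed
  ultimately have "bij_betw ?f (UNIV \<times> span B) (span (insert b B))"
    by (simp add: bij_betw_def)
  then have "finite (span (insert b B)) = finite ((UNIV :: 'a set) \<times> span B)"
    and "card (span (insert b B)) = card ((UNIV :: 'a set) \<times> span B)"
    by (simp_all add: bij_betw_finite bij_betw_same_card)
  with insert fin card show ?case
    by (simp add: card_cartesian_product Q_def)
qed simp

lemma obtain_basis:
  assumes "subspace W" "finite W"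
  obtains B where "B \<subseteq> W" "independent B" "finite B" "span B = W" "card W = Q ^ card B"
proof -
  obtain B where B: "B \<subseteq> W" "independent B" "W \<subseteq> span B"
    using maximal_independent_subset by blast
  have "finite B"
    using B(1) assms(2) finite_subset by blast
  moreover have "span B = W"
    using span_minimal[OF B(1) assms(1)] B(3) by simp
  ultimately show ?thesis
    using card_span_independent[of B] B that by simp
qed

lemma obtain_dim:
  assumes "subspace W" "finite W"
  obtains d where "card W = Q ^ d"
  using obtain_basis[OF assms] by metis

lemma subspace_ssum: "subspace U \<Longrightarrow> subspace V \<Longrightarrow> subspace (ssum U V)"
  unfolding ssum_def by (rule subspace_sums)

lemma ssum_upper: "subspace U \<Longrightarrow> subspace V \<Longrightarrow> U \<subseteq> ssum U V \<and> V \<subseteq> ssum U V"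
proof (intro conjI subsetI)
  fix x assume UV: "subspace U" "subspace V"
  show "x \<in> ssum U V" if "x \<in> U"
    unfolding ssum_def using that subspace_0[OF UV(2)] by (intro CollectI exI[of _ x] exI[of _ 0]) simp
  show "x \<in> ssum U V" if "x \<in> V"
    unfolding ssum_def using that subspace_0[OF UV(1)] by (intro CollectI exI[of _ 0] exI[of _ x]) simp
qed

lemma ssum_least:
  assumes "subspace U" "subspace V" "subspace W"
  shows "ssum U V \<subseteq> W \<longleftrightarrow> U \<subseteq> W \<and> V \<subseteq> W"
proof
  assume "ssum U V \<subseteq> W"
  then show "U \<subseteq> W \<and> V \<subseteq> W"
    using ssum_upper[OF assms(1,2)] by (meson order_trans)
next
  assume "U \<subseteq> W \<and> V \<subseteq> W"
  then show "ssum U V \<subseteq> W"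
    using assms(3) by (auto simp: ssum_def intro!: subspace_add)
qed

text \<open>The dimension formula in terms of cardinality: every fibre of addition on
  \<open>U \<times> V\<close> over the sum is a translate of \<open>U \<inter> V\<close>, embedded
  as \<open>(w, - w)\<close>.\<close>

lemma card_ssum:
  assumes "subspace U" "subspace V" "finite U" "finite V"
  shows "card (ssum U V) * card (U \<inter> V) = card U * card V"
proof -
  let ?f = "\<lambda>(u, v). u + v"
  have fib: "card {p \<in> U \<times> V. ?f p = x} = card (U \<inter> V)" if x: "x \<in> ssum U V" for x
  proof -
    obtain u v where uv: "u \<in> U" "v \<in> V" "x = u + v"
      using x by (auto simp: ssum_def)
    have "bij_betw (\<lambda>w. (u + w, v - w)) (U \<inter> V) {p \<in> U \<times> V. ?f p = x}"
    proof (rule bij_betw_byWitness[of _ "\<lambda>p. fst p - u"])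
      show "(\<lambda>w. (u + w, v - w)) ` (U \<inter> V) \<subseteq> {p \<in> U \<times> V. ?f p = x}"
        using uv assms by (auto simp: subspace_add subspace_diff)
      have "a - u = v - b" if "a + b = u + v" for a b
        using that by (simp add: algebra_simps)
      then show "(\<lambda>p. fst p - u) ` {p \<in> U \<times> V. ?f p = x} \<subseteq> U \<inter> V"
        using uv assms by (auto simp: subspace_diff) (metis subspace_diff)
    qed (use uv in \<open>auto simp: algebra_simps\<close>)
    then show ?thesis
      by (simp add: bij_betw_same_card)
  qed
  have im: "?f ` (U \<times> V) = ssum U V"
    by (auto simp: ssum_def)
  have "card (U \<times> V) = (\<Sum>x\<in>ssum U V. card {p \<in> U \<times> V. ?f p = x})"
    using assms im by (intro card_eq_sum_card_vimage) (auto simp flip: im)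
  then show ?thesis
    using fib by (simp add: card_cartesian_product)
qed

text \<open>The complement is spanned by the vectors that extend a basis of \<open>A\<close> to one
  of \<open>E\<close>. That it meets \<open>A\<close> only in 0 follows by comparing
  cardinalities.\<close>

lemma obtain_complement:
  assumes "subspace A" "subspace E" "A \<subseteq> E" "finite E"
  obtains C where "subspace C" "C \<subseteq> E" "A \<inter> C = {0}" "ssum A C = E"
proof -
  obtain B where B: "B \<subseteq> A" "independent B" "A \<subseteq> span B"
    using maximal_independent_subset by blast
  have "B \<subseteq> E"
    using B(1) assms(3) by simp
  from maximal_independent_subset_extend[OF this B(2)]
  obtain B' where B': "B \<subseteq> B'" "B' \<subseteq> E" "independent B'" "E \<subseteq> span B'" .
  have A: "span B = A" and E: "span B' = E"
    using span_minimal[OF B(1) assms(1)] span_minimal[OF B'(2) assms(2)] B(3) B'(4) by simp_all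
  let ?C = "span (B' - B)"
  have sp: "ssum A ?C = span (B \<union> (B' - B))"
    unfolding span_Un ssum_def A by simp
  have CE: "?C \<subseteq> E"
    using span_mono[of "B' - B" B'] E by auto
  have ssum: "ssum A ?C = E"
    using sp B' E by (simp add: Un_absorb1)
  have fin: "finite A" "finite ?C" "finite B'" "finite B"
    using assms B B' CE finite_subset by metis+
  have "card E * card (A \<inter> ?C) = card A * card ?C"
    using card_ssum[of A ?C] assms fin ssum by simp
  also have "\<dots> = Q ^ (card B + card (B' - B))"
    using card_span_independent[of B] card_span_independent[of "B' - B"] fin A B
      independent_mono[OF B'(3), of "B' - B"] by (simp add: power_add)
  also have "card B + card (B' - B) = card B'"
    using fin B' by (simp add: card_Diff_subset card_mono)
  also have "Q ^ card B' = card E"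
    using card_span_independent[of B'] fin E B' by simp
  finally have "card (A \<inter> ?C) = 1"
    using assms subspace_0 by (auto simp: card_gt_0_iff)
  moreover have "0 \<in> A \<inter> ?C"
    using assms subspace_0 span_zero by auto
  ultimately have "A \<inter> ?C = {0}"
    by (metis card_1_singletonE singletonD)
  then show ?thesis
    using that[of ?C] CE ssum by simp
qed

text \<open>The modular law. Together with \<open>Int_ssum_eq\<close> it makes intersecting with
  \<open>C\<close> and adding \<open>A\<close> mutually inverse.\<close>

lemma ssum_Int_eq:
  assumes A: "subspace A" and C: "subspace C" "A \<inter> C = {0}" and W: "subspace W" "A \<subseteq> W" "W \<subseteq> ssum A C"
  shows "ssum A (W \<inter> C) = W"
proof (rule antisym)
  show "ssum A (W \<inter> C) \<subseteq> W"
    using ssum_least[OF A subspace_inter[OF W(1) C(1)] W(1)] W(2) by simp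
next
  show "W \<subseteq> ssum A (W \<inter> C)"
  proof
    fix x assume x: "x \<in> W"
    then obtain a c where ac: "a \<in> A" "c \<in> C" "x = a + c"
      using W(3) by (auto simp: ssum_def)
    have "x - a \<in> W"
      using subspace_diff[OF W(1) x] ac(1) W(2) by blast
    then have "c \<in> W"
      using ac(3) by simp
    then show "x \<in> ssum A (W \<inter> C)"
      using ac by (auto simp: ssum_def)
  qed
qed

lemma Int_ssum_eq:
  assumes A: "subspace A" and C: "subspace C" "A \<inter> C = {0}" and U: "subspace U" "U \<subseteq> C"
  shows "ssum A U \<inter> C = U"
proof (intro equalityI subsetI)
  fix x assume x: "x \<in> ssum A U \<inter> C"
  then obtain a u where au: "a \<in> A" "u \<in> U" "x = a + u"
    unfolding ssum_def by blast
  have "x - u \<in> C"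
    using subspace_diff[OF C(1)] x au(2) U(2) by blast
  then have "a \<in> C"
    using au(3) by simp
  then have "a = 0"
    using au C by blast
  then show "x \<in> U"
    using au by simp
next
  fix x assume "x \<in> U"
  then show "x \<in> ssum A U \<inter> C"
    using ssum_upper[OF A U(1)] U(2) by auto
qed

lemma card_ssum_direct:
  assumes "subspace A" "subspace C" "A \<inter> C = {0}" "finite A" "finite C"
  shows "card (ssum A C) = card A * card C"
  using card_ssum[of A C] assms by simp

text \<open>A complement \<open>C\<close> plays the role of the quotient of \<open>E\<close> by
  \<open>A\<close>: subspaces of \<open>E\<close> above \<open>A\<close> correspond to subspaces of
  \<open>C\<close>.\<close>

lemma card_grass_above:
  assumes E: "subspace E" "finite E" "card E = Q ^ n" and A: "subspace A" "A \<subseteq> E" "card A = Q ^ a"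
  obtains C where "subspace C" "finite C" "card C = Q ^ (n - a)" "a \<le> n"
    "\<And>d. a \<le> d \<Longrightarrow> card {W \<in> grass d E. A \<subseteq> W} = card (grass (d - a) C)"
proof -
  obtain C where C: "subspace C" "C \<subseteq> E" "A \<inter> C = {0}" "ssum A C = E"
    using obtain_complement[OF A(1) E(1) A(2) E(2)] .
  have fin: "finite A" "finite C"
    using finite_subset[OF _ E(2)] A C by blast+
  have "Q ^ n = Q ^ a * card C"
    using card_ssum_direct[OF A(1) C(1) C(3) fin] C A E by simp
  moreover obtain c where c: "card C = Q ^ c"
    using obtain_dim[OF C(1) fin(2)] .
  ultimately have n: "n = a + c"
    by (simp flip: power_add)
  have "card {W \<in> grass d E. A \<subseteq> W} = card (grass (d - a) C)" if d: "a \<le> d" for d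
  proof -
    have cd: "card (ssum A U) = Q ^ d \<longleftrightarrow> card U = Q ^ (d - a)" if U: "subspace U" "U \<subseteq> C" for U
    proof -
      have "0 \<in> A \<inter> U"
        using subspace_0[OF U(1)] subspace_0[OF A(1)] by simp
      then have "A \<inter> U = {0}" "finite U"
        using U(2) C(3) finite_subset[OF U(2) fin(2)] by auto
      then have "card (ssum A U) = Q ^ a * card U"
        using card_ssum_direct[OF A(1) U(1)] A fin by simp
      moreover have "Q ^ d = Q ^ a * Q ^ (d - a)"
        using d by (simp flip: power_add)
      ultimately show ?thesis using card_pos by (metis nat_mult_eq_cancel1 zero_less_power)
    qed
    have "bij_betw (\<lambda>W. W \<inter> C) {W \<in> grass d E. A \<subseteq> W} (grass (d - a) C)"
    proof (rule bij_betw_byWitness[of _ "ssum A"])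
      have *: "ssum A (W \<inter> C) = W" if "W \<in> {W \<in> grass d E. A \<subseteq> W}" for W
        using ssum_Int_eq[OF A(1) C(1) C(3)] C(4) that by (simp add: grass_def)
      then show "\<forall>W\<in>{W \<in> grass d E. A \<subseteq> W}. ssum A (W \<inter> C) = W"
        by simp
      show "\<forall>U\<in>grass (d - a) C. ssum A U \<inter> C = U"
        using Int_ssum_eq[OF A(1) C(1) C(3)] by (simp add: grass_def)
      show "(\<lambda>W. W \<inter> C) ` {W \<in> grass d E. A \<subseteq> W} \<subseteq> grass (d - a) C"
      proof (rule image_subsetI)
        fix W assume W: "W \<in> {W \<in> grass d E. A \<subseteq> W}"
        then show "W \<inter> C \<in> grass (d - a) C"
          using *[OF W] cd[of "W \<inter> C"] C(1) by (simp add: grass_def subspace_inter)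
      qed
      show "ssum A ` grass (d - a) C \<subseteq> {W \<in> grass d E. A \<subseteq> W}"
      proof (rule image_subsetI)
        fix U assume "U \<in> grass (d - a) C"
        then have U: "subspace U" "U \<subseteq> C" "card U = Q ^ (d - a)"
          by (simp_all add: grass_def)
        have "U \<subseteq> E"
          using U(2) C(2) by simp
        then show "ssum A U \<in> {W \<in> grass d E. A \<subseteq> W}"
          using cd[OF U(1,2)] U ssum_upper[OF A(1) U(1)] ssum_least[OF A(1) U(1) E(1)] A
          by (simp add: grass_def subspace_ssum)
      qed
    qed
    then show ?thesis
      by (rule bij_betw_same_card)
  qed
  then show ?thesis
    using that[of C] C(1) fin(2) c n by simp
qed

end

section \<open>Gaussian binomials as numbers of subspaces\<close>

locale finite_field_counting = finite_field_vector_space scale Q + q_number q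
  for scale :: "'a::{field,finite} \<Rightarrow> 'v::ab_group_add \<Rightarrow> 'v" (infixr "*s" 75)
    and Q :: nat and q :: "'b::field_char_0" +
  assumes q_eq: "q = of_nat Q"
begin

lemma grass_0: "subspace E \<Longrightarrow> grass 0 E = {{0}}"
proof (intro equalityI subsetI)
  fix W assume E: "subspace E" and "W \<in> grass 0 E"
  then have "subspace W" "card W = 1"
    by (simp_all add: grass_def)
  then show "W \<in> {{0 :: 'v}}"
    using subspace_0[of W] by (metis card_1_singletonE singletonD singletonI)
next
  fix W assume "subspace E" "W \<in> {{0 :: 'v}}"
  then show "W \<in> grass 0 E"
    using subspace_0 by (simp add: grass_def)
qed

lemma grass_empty:
  assumes "finite E" "card E = Q ^ n" "n < k"
  shows "grass k E = {}"
proof -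
  have False if "W \<in> grass k E" for W
    using that card_mono[OF assms(1), of W] assms(2,3) card_power_le_iff[of k n] by (simp add: grass_def)
  then show ?thesis by blast
qed

text \<open>Pairs of a nonzero vector and a \<open>k\<close>-dimensional subspace through it are
  counted in two ways. The subspaces through a given line correspond to the subspaces of dimension
  \<open>k - 1\<close> of a complement, and \<open>gauss_absorb\<close> is the resulting
  equation.\<close>

theorem card_grass:
  assumes "subspace E" "finite E" "card E = Q ^ n"
  shows "of_nat (card (grass k E)) = gauss n k"
  using assms
proof (induction n arbitrary: E k)
  case 0
  then show ?case
    by (cases k) (simp_all add: grass_0 grass_empty[of E 0] gauss_eq_0)
next
  case (Suc n)
  show ?case
  proof (cases k)
    case 0
    then show ?thesis using Suc.prems by (simp add: grass_0)
  next
    case (Suc k')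
    have through: "of_nat (card {W \<in> grass (Suc k') E. x \<in> W}) = gauss n k'" if x: "x \<in> E - {0}" for x
    proof -
      have "independent {x}"
        using x by simp
      then have c: "card (span {x}) = Q ^ 1"
        using card_span_independent[of "{x}"] by simp
      have sub: "span {x} \<subseteq> E"
        using x Suc.prems(1) by (intro span_minimal) auto
      obtain C where C: "subspace C" "finite C" "card C = Q ^ (Suc n - 1)"
        "\<And>d. 1 \<le> d \<Longrightarrow> card {W \<in> grass d E. span {x} \<subseteq> W} = card (grass (d - 1) C)"
        using card_grass_above[OF Suc.prems subspace_span sub c] by metis
      have "span {x} \<subseteq> W \<longleftrightarrow> x \<in> W" if "W \<in> grass (Suc k') E" for W
        using that span_minimal[of "{x}" W] span_base[of x "{x}"] by (auto simp: grass_def)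
      then have "{W \<in> grass (Suc k') E. x \<in> W} = {W \<in> grass (Suc k') E. span {x} \<subseteq> W}"
        by blast
      then show ?thesis
        using C(4)[of "Suc k'"] Suc.IH[OF C(1,2), of k'] C(3) by simp
    qed
    have pts: "card {x \<in> E - {0}. x \<in> W} = Q ^ Suc k' - 1" if "W \<in> grass (Suc k') E" for W
    proof -
      have "{x \<in> E - {0}. x \<in> W} = W - {0}"
        using that by (auto simp: grass_def)
      moreover have "0 \<in> W" "finite W" "card W = Q ^ Suc k'"
        using that subspace_0 finite_subset[OF _ Suc.prems(2)] by (auto simp: grass_def)
      ultimately show ?thesis by (simp add: card_Diff_subset)
    qed
    have "card (grass (Suc k') E) * (Q ^ Suc k' - 1) =
        (\<Sum>W\<in>grass (Suc k') E. card {x \<in> E - {0}. x \<in> W})"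
      using pts by simp
    also have "\<dots> = (\<Sum>x\<in>E - {0}. card {W \<in> grass (Suc k') E. x \<in> W})"
      using Suc.prems by (intro card_Collect_swap) auto
    finally have "of_nat (card (grass (Suc k') E) * (Q ^ Suc k' - 1)) =
        (\<Sum>x\<in>E - {0}. of_nat (card {W \<in> grass (Suc k') E. x \<in> W}) :: 'b)"
      by simp
    also have "\<dots> = of_nat (card (E - {0})) * gauss n k'"
      using through by simp
    also have "card (E - {0}) = Q ^ Suc n - 1"
      using Suc.prems subspace_0 by (simp add: card_Diff_subset)
    finally have "(q ^ Suc k' - 1) * of_nat (card (grass (Suc k') E)) = (q ^ Suc n - 1) * gauss n k'"
      by (simp add: of_nat_diff q_eq Suc_leI mult.commute)
    also have "\<dots> = (q ^ Suc k' - 1) * gauss (Suc n) (Suc k')"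
      by (rule gauss_absorb[symmetric])
    finally show ?thesis
      using q_power_neq_1[of "Suc k'"] Suc by simp
  qed
qed

lemma card_grass_containing:
  assumes E: "subspace E" "finite E" "card E = Q ^ n" and A: "subspace A" "A \<subseteq> E" "card A = Q ^ a"
  shows "of_nat (card {W \<in> grass d E. A \<subseteq> W}) = (if a \<le> d then gauss (n - a) (d - a) else 0)"
proof (cases "a \<le> d")
  case True
  obtain C where C: "subspace C" "finite C" "card C = Q ^ (n - a)"
    "\<And>d. a \<le> d \<Longrightarrow> card {W \<in> grass d E. A \<subseteq> W} = card (grass (d - a) C)"
    using card_grass_above[OF assms] by metis
  then show ?thesis
    using True card_grass[OF C(1-3)] by simp
next
  case False
  have "{W \<in> grass d E. A \<subseteq> W} = {}"
  proof -
    have False if "W \<in> grass d E" "A \<subseteq> W" for W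
    proof -
      have "finite W" "card W = Q ^ d"
        using that finite_subset[OF _ E(2)] by (auto simp: grass_def)
      then show False
        using card_mono[of W A] that A(3) card_power_le_iff[of a d] False by simp
    qed
    then show ?thesis by blast
  qed
  then show ?thesis
    unfolding \<open>{W \<in> grass d E. A \<subseteq> W} = {}\<close> using False by simp
qed

end

section \<open>Operators on finite vector spaces\<close>

locale linear_operator_on = finite_field_counting scale Q q
  for scale :: "'a::{field,finite} \<Rightarrow> 'v::ab_group_add \<Rightarrow> 'v" (infixr "*s" 75)
    and Q :: nat and q :: "'b::field_char_0" +
  fixes E :: "'v set" and n :: nat and f :: "'v \<Rightarrow> 'v"
  assumes E: "subspace E" "finite E" "card E = Q ^ n"
    and f_add: "x \<in> E \<Longrightarrow> y \<in> E \<Longrightarrow> f (x + y) = f x + f y"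
    and f_scale: "x \<in> E \<Longrightarrow> f (c *s x) = c *s f x"
    and f_in: "x \<in> E \<Longrightarrow> f x \<in> E"
begin

lemma f_0: "f 0 = 0"
  using f_add[of 0 0] subspace_0[OF E(1)] by simp

lemma subspace_image:
  assumes "subspace U" "U \<subseteq> E"
  shows "subspace (f ` U)"
proof (rule subspaceI)
  show "0 \<in> f ` U"
    using subspace_0[OF assms(1)] f_0 by force
  show "x + y \<in> f ` U" if "x \<in> f ` U" "y \<in> f ` U" for x y
  proof -
    from that obtain u v where "u \<in> U" "v \<in> U" "x = f u" "y = f v" by blast
    then show ?thesis
      using f_add[of u v] subspace_add[OF assms(1), of u v] assms(2) by (metis imageI subsetD)
  qed
  show "c *s x \<in> f ` U" if "x \<in> f ` U" for c x
  proof -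
    from that obtain u where "u \<in> U" "x = f u" by blast
    then show ?thesis
      using f_scale[of u c] subspace_scale[OF assms(1), of u c] assms(2) by (metis imageI subsetD)
  qed
qed

theorem card_invariant:
  assumes K: "subspace K" "K \<subseteq> E" "card K = Q ^ m" and K_iff: "\<And>x. x \<in> E \<Longrightarrow> f x = 0 \<longleftrightarrow> x \<in> K"
    and I: "f ` E = I" "card I = Q ^ e" "0 < e" "inj_on f I"
    and simple: "\<And>U. subspace U \<Longrightarrow> U \<subseteq> I \<Longrightarrow> f ` U \<subseteq> U \<Longrightarrow> U = {0} \<or> U = I"
  shows "of_nat (card {W \<in> grass j E. f ` W \<subseteq> W}) =
    gauss m j + (if e \<le> j then gauss (n - e) (j - e) else 0)"
proof -
  have I_sub: "subspace I" "I \<subseteq> E"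
    using subspace_image[OF E(1) order_refl] I(1) f_in by auto
  have "{W \<in> grass j E. f ` W \<subseteq> W} = grass j K \<union> {W \<in> grass j E. I \<subseteq> W}"
  proof (intro equalityI subsetI)
    fix W assume "W \<in> {W \<in> grass j E. f ` W \<subseteq> W}"
    then have W: "subspace W" "W \<subseteq> E" "card W = Q ^ j" "f ` W \<subseteq> W" and Wg: "W \<in> grass j E"
      by (simp_all add: grass_def)
    have "f ` W = {0} \<or> f ` W = I"
      using simple[OF subspace_image[OF W(1,2)]] W(2,4) I(1) by blast
    then show "W \<in> grass j K \<union> {W \<in> grass j E. I \<subseteq> W}"
    proof
      assume "f ` W = {0}"
      then have "W \<subseteq> K"
        using K_iff W(2) by blast
      then show ?thesis
        using W by (simp add: grass_def)
    next
      assume "f ` W = I"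
      then show ?thesis
        using W(4) Wg by simp
    qed
  next
    fix W assume "W \<in> grass j K \<union> {W \<in> grass j E. I \<subseteq> W}"
    then show "W \<in> {W \<in> grass j E. f ` W \<subseteq> W}"
    proof
      assume "W \<in> grass j K"
      then have W: "subspace W" "W \<subseteq> K" "card W = Q ^ j"
        by (simp_all add: grass_def)
      then have "f x = 0" if "x \<in> W" for x
        using that K(2) K_iff by blast
      then have "f ` W \<subseteq> W"
        using subspace_0[OF W(1)] by auto
      moreover have "W \<subseteq> E"
        using W(2) K(2) by blast
      ultimately show ?thesis
        using W by (simp add: grass_def)
    next
      assume W: "W \<in> {W \<in> grass j E. I \<subseteq> W}"
      then have "f ` W \<subseteq> W"
        using I(1) by (auto simp: grass_def)
      with W show ?thesis by simp
    qed
  qed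
  moreover have "grass j K \<inter> {W \<in> grass j E. I \<subseteq> W} = {}"
  proof -
    have False if "W \<subseteq> K" "I \<subseteq> W" for W
    proof -
      have "f x = f 0" if "x \<in> I" for x
        using that \<open>W \<subseteq> K\<close> \<open>I \<subseteq> W\<close> K_iff I_sub(2) f_0 by auto
      then have "x = 0" if "x \<in> I" for x
        using that inj_onD[OF I(4)] subspace_0[OF I_sub(1)] by blast
      then have "I = {0}"
        using subspace_0[OF I_sub(1)] by blast
      then have "Q ^ 0 = Q ^ e"
        using I(2) by simp
      then show False
        using I(3) by (simp only: card_power_inject)
    qed
    then show ?thesis
      by (fastforce simp: grass_def)
  qed
  moreover have "finite K"
    using finite_subset[OF K(2) E(2)] .
  ultimately have "card {W \<in> grass j E. f ` W \<subseteq> W} =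
      card (grass j K) + card {W \<in> grass j E. I \<subseteq> W}"
    using E(2) by (simp add: card_Un_disjoint)
  then show ?thesis
    using card_grass[OF K(1) \<open>finite K\<close> K(3)] card_grass_containing[OF E I_sub I(2)] by simp
qed

lemma card_invariant_simple:
  assumes "0 < n"
    and f_simple: "\<And>W. subspace W \<Longrightarrow> W \<subseteq> E \<Longrightarrow> f ` W \<subseteq> W \<Longrightarrow> W = {0} \<or> W = E"
  shows "card {W \<in> grass j E. f ` W \<subseteq> W} = of_bool (j = 0) + of_bool (j = n)"
proof -
  have "card E \<noteq> Q ^ 0"
    unfolding E(3) card_power_inject using assms(1) by simp
  then have E0: "E \<noteq> {0}"
    by auto
  have "{W \<in> grass j E. f ` W \<subseteq> W} = (if j = 0 then {{0}} else {}) \<union> (if j = n then {E} else {})"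
  proof (intro equalityI subsetI)
    fix W assume "W \<in> {W \<in> grass j E. f ` W \<subseteq> W}"
    then have W: "subspace W" "W \<subseteq> E" "card W = Q ^ j" "f ` W \<subseteq> W"
      by (simp_all add: grass_def)
    from f_simple[OF W(1,2,4)]
    show "W \<in> (if j = 0 then {{0}} else {}) \<union> (if j = n then {E} else {})"
    proof
      assume "W = {0}"
      then have "Q ^ j = Q ^ 0" using W(3) by simp
      then show ?thesis using \<open>W = {0}\<close> by (simp only: card_power_inject) simp
    next
      assume "W = E"
      then show ?thesis using W(3) E(3) by simp
    qed
  next
    fix W assume "W \<in> (if j = 0 then {{0}} else {}) \<union> (if j = n then {E} else {})"
    then consider "j = 0" "W = {0}" | "j = n" "W = E"
      by (auto split: if_splits)
    then show "W \<in> {W \<in> grass j E. f ` W \<subseteq> W}"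
      using E f_in f_0 subspace_0[OF E(1)] by cases (auto simp: grass_def)
  qed
  then show ?thesis
    using E0 by simp
qed

lemma card_anti_invariant_0: "card {W \<in> grass 0 E. card (ssum W (f ` W)) = Q ^ (2 * 0)} = 1"
proof -
  have "ssum {0} (f ` {0}) = {0}"
    by (simp add: ssum_def f_0)
  then have "{W \<in> grass 0 E. card (ssum W (f ` W)) = Q ^ (2 * 0)} = {{0}}"
    using grass_0[OF E(1)] by auto
  then show ?thesis by simp
qed

lemma no_anti_invariant:
  assumes "f ` E \<subseteq> I" "finite I" "card I = Q ^ e" "e < l"
  shows "{W \<in> grass l E. card (ssum W (f ` W)) = Q ^ (2 * l)} = {}"
proof -
  have False if "W \<in> grass l E" "card (ssum W (f ` W)) = Q ^ (2 * l)" for W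
  proof -
    have W: "subspace W" "W \<subseteq> E" "finite W" "card W = Q ^ l"
      using that finite_subset[OF _ E(2)] by (auto simp: grass_def)
    have fW: "subspace (f ` W)" "finite (f ` W)"
      using subspace_image[OF W(1,2)] W(3) by simp_all
    have "0 \<in> W \<inter> f ` W"
      using subspace_0[OF W(1)] subspace_0[OF fW(1)] by simp
    then have "0 < card (W \<inter> f ` W)"
      using W(3) by (auto simp: card_gt_0_iff)
    then have "Q ^ (2 * l) \<le> card W * card (f ` W)"
      using card_ssum[OF W(1) fW(1) W(3) fW(2)] that(2) by (metis One_nat_def Suc_leI mult.right_neutral mult_le_mono2)
    also have "\<dots> \<le> Q ^ l * Q ^ e"
      using card_mono[OF assms(2), of "f ` W"] assms(1,3) W by (simp add: subset_trans[OF image_mono])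
    finally show False
      using assms(4) card_power_le_iff[of "2 * l" "l + e"] by (simp add: power_add)
  qed
  then show ?thesis by blast
qed

end

section \<open>Subspaces classified by the dimension of their core\<close>

locale simple_operator = linear_operator_on scale Q q E n f
  for scale :: "'a::{field,finite} \<Rightarrow> 'v::ab_group_add \<Rightarrow> 'v" (infixr "*s" 75)
    and Q :: nat and q :: "'b::field_char_0" and E n f +
  assumes f_inj: "inj_on f E"
    and f_simple: "subspace W \<Longrightarrow> W \<subseteq> E \<Longrightarrow> f ` W \<subseteq> W \<Longrightarrow> W = {0} \<or> W = E"
begin

definition core :: "'v set \<Rightarrow> 'v set" where
  "core W = {x \<in> W. f x \<in> W}"

definition num_core :: "nat \<Rightarrow> nat \<Rightarrow> nat" where
  "num_core a b = card {W \<in> grass a E. card (core W) = Q ^ b}"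

lemma subspace_core:
  assumes "subspace W" "W \<subseteq> E"
  shows "subspace (core W)"
proof (rule subspaceI)
  show "0 \<in> core W"
    using subspace_0[OF assms(1)] f_0 by (simp add: core_def)
  show "x + y \<in> core W" if "x \<in> core W" "y \<in> core W" for x y
    using that subspace_add[OF assms(1)] f_add[OF subsetD[OF assms(2)] subsetD[OF assms(2)], of x y]
    by (auto simp: core_def)
  show "c *s x \<in> core W" if "x \<in> core W" for c x
    using that subspace_scale[OF assms(1)] f_scale[OF subsetD[OF assms(2)], of x c]
    by (auto simp: core_def)
qed

lemma core_subset: "core W \<subseteq> W"
  by (auto simp: core_def)

lemma image_core: "W \<subseteq> E \<Longrightarrow> W \<inter> f ` W = f ` core W"
  by (auto simp: core_def)

lemma obtain_core_dim:
  assumes "W \<in> grass a E"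
  obtains c where "c \<le> a" "card (core W) = Q ^ c"
proof -
  have W: "subspace W" "W \<subseteq> E" "finite W" "card W = Q ^ a"
    using assms finite_subset[OF _ E(2)] by (auto simp: grass_def)
  from obtain_dim[OF subspace_core[OF W(1,2)] finite_subset[OF core_subset W(3)]]
  obtain c where c: "card (core W) = Q ^ c" .
  moreover have "c \<le> a"
    using card_mono[OF W(3) core_subset] c W(4) card_power_le_iff by simp
  ultimately show ?thesis using that by blast
qed

lemma sum_grass_by_core:
  "(\<Sum>W\<in>grass a E. h (card (core W))) = (\<Sum>c\<le>a. of_nat (num_core a c) * h (Q ^ c) :: 'b)"
proof -
  have "(\<Sum>W\<in>grass a E. h (card (core W))) =
      (\<Sum>c\<le>a. \<Sum>W\<in>{W \<in> grass a E. card (core W) = Q ^ c}. h (card (core W)))"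
  proof -
    have "grass a E = (\<Union>c\<in>{..a}. {W \<in> grass a E. card (core W) = Q ^ c})"
    proof (intro equalityI subsetI)
      fix W assume W: "W \<in> grass a E"
      from obtain_core_dim[OF W] obtain c where "c \<le> a" "card (core W) = Q ^ c" .
      with W show "W \<in> (\<Union>c\<in>{..a}. {W \<in> grass a E. card (core W) = Q ^ c})"
        by blast
    qed blast
    then have "(\<Sum>W\<in>grass a E. h (card (core W))) =
        (\<Sum>W\<in>(\<Union>c\<in>{..a}. {W \<in> grass a E. card (core W) = Q ^ c}). h (card (core W)))"
      by simp
    also have "\<dots> = (\<Sum>c\<le>a. \<Sum>W\<in>{W \<in> grass a E. card (core W) = Q ^ c}. h (card (core W)))"
      using E(2) by (intro sum.UNION_disjoint) auto
    finally show ?thesis .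
  qed
  also have "\<dots> = (\<Sum>c\<le>a. of_nat (num_core a c) * h (Q ^ c))"
    by (intro sum.cong) (auto simp: num_core_def)
  finally show ?thesis .
qed

lemma card_sum_image:
  assumes "U \<in> grass b E" "card (core U) = Q ^ c" "c \<le> b"
  shows "card (ssum U (f ` U)) = Q ^ (2 * b - c)"
proof -
  have U: "subspace U" "U \<subseteq> E" "finite U" "card U = Q ^ b"
    using assms finite_subset[OF _ E(2)] by (auto simp: grass_def)
  have "card (U \<inter> f ` U) = Q ^ c"
    using image_core[OF U(2)] assms(2) core_subset[of U] U(2) inj_on_subset[OF f_inj]
    by (simp add: card_image subset_trans)
  moreover have "card (f ` U) = Q ^ b"
    using inj_on_subset[OF f_inj U(2)] U(4) by (simp add: card_image)
  ultimately have "card (ssum U (f ` U)) * Q ^ c = Q ^ (2 * b - c) * Q ^ c"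
    using card_ssum[OF U(1) subspace_image[OF U(1,2)]] U(3,4) assms(3)
    by (simp add: mult_2 flip: power_add)
  then show ?thesis using card_pos by simp
qed

text \<open>Both sides count the pairs \<open>U \<subseteq> W\<close> with \<open>dim U = b\<close>, \<open>dim W = a\<close> and \<open>f ` U \<subseteq> W\<close>.\<close>

lemma core_recurrence:
  "(\<Sum>c\<le>a. of_nat (num_core a c) * gauss c b) =
   (\<Sum>c\<le>b. of_nat (num_core b c) *
      (if 2 * b - c \<le> a then gauss (n - (2 * b - c)) (a - (2 * b - c)) else 0))"
proof -
  \<comment> \<open>Recovers the dimension from the cardinality, since
    \<open>sum_grass_by_core\<close> takes functions of the cardinality of the core.\<close>
  define d where "d k = (THE c. k = Q ^ c)" for k
  have d [simp]: "d (Q ^ c) = c" for c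
    unfolding d_def by (rule the_equality) auto
  have below: "of_nat (card {U \<in> grass b E. U \<subseteq> core W}) = gauss (d (card (core W))) b"
    if "W \<in> grass a E" for W
  proof -
    from obtain_core_dim[OF that] obtain c where c: "card (core W) = Q ^ c" .
    have W: "subspace W" "W \<subseteq> E"
      using that by (auto simp: grass_def)
    have "core W \<subseteq> E"
      using core_subset W(2) by blast
    then have "{U \<in> grass b E. U \<subseteq> core W} = grass b (core W)" "finite (core W)"
      using finite_subset[OF _ E(2)] by (auto simp: grass_def)
    then show ?thesis
      using card_grass[OF subspace_core[OF W] _ c] c by simp
  qed
  have above: "of_nat (card {W \<in> grass a E. U \<subseteq> core W}) =
      (let c = d (card (core U))
       in if 2 * b - c \<le> a then gauss (n - (2 * b - c)) (a - (2 * b - c)) else 0)"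
    if "U \<in> grass b E" for U
  proof -
    from obtain_core_dim[OF that] obtain c where c: "c \<le> b" "card (core U) = Q ^ c" .
    have U: "subspace U" "U \<subseteq> E"
      using that by (auto simp: grass_def)
    have fU: "subspace (f ` U)" "f ` U \<subseteq> E"
      using subspace_image[OF U] U(2) f_in by auto
    have "U \<subseteq> core W \<longleftrightarrow> ssum U (f ` U) \<subseteq> W" if "W \<in> grass a E" for W
    proof -
      have "ssum U (f ` U) \<subseteq> W \<longleftrightarrow> U \<subseteq> W \<and> f ` U \<subseteq> W"
        using that ssum_least[OF U(1) fU(1)] by (simp add: grass_def)
      then show ?thesis
        by (auto simp: core_def)
    qed
    then have "{W \<in> grass a E. U \<subseteq> core W} = {W \<in> grass a E. ssum U (f ` U) \<subseteq> W}"
      by blast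
    moreover have "ssum U (f ` U) \<subseteq> E"
      using ssum_least[OF U(1) fU(1) E(1)] U(2) fU(2) by simp
    ultimately show ?thesis
      using card_grass_containing[OF E subspace_ssum[OF U(1) fU(1)] _ card_sum_image[OF that c(2,1)], of a] c
      by simp
  qed
  have "(\<Sum>c\<le>a. of_nat (num_core a c) * gauss c b) =
      (\<Sum>W\<in>grass a E. of_nat (card {U \<in> grass b E. U \<subseteq> core W}))"
    using sum_grass_by_core[of "\<lambda>k. gauss (d k) b" a] below by simp
  also have "\<dots> = (\<Sum>U\<in>grass b E. of_nat (card {W \<in> grass a E. U \<subseteq> core W}))"
    unfolding of_nat_sum[symmetric] using E(2)
    by (intro arg_cong[of _ _ of_nat] card_Collect_swap) auto
  also have "\<dots> = (\<Sum>c\<le>b. of_nat (num_core b c) *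
      (if 2 * b - c \<le> a then gauss (n - (2 * b - c)) (a - (2 * b - c)) else 0))"
    using sum_grass_by_core[of "\<lambda>k. let c = d k
       in if 2 * b - c \<le> a then gauss (n - (2 * b - c)) (a - (2 * b - c)) else 0" b] above
    by (simp add: Let_def)
  finally show ?thesis .
qed

lemma num_core_0: "num_core 0 0 = 1"
proof -
  have "core {0} = {0}"
    by (auto simp: core_def f_0)
  then have "{W \<in> grass 0 E. card (core W) = Q ^ 0} = {{0}}"
    using grass_0[OF E(1)] by auto
  then show ?thesis by (simp add: num_core_def)
qed

text \<open>A core of full dimension is all of \<open>W\<close>, which makes \<open>W\<close> a
  proper invariant subspace.\<close>

lemma num_core_self:
  assumes "0 < a" "a < n"
  shows "num_core a a = 0"
proof -
  have False if "W \<in> grass a E" "card (core W) = Q ^ a" for W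
  proof -
    have W: "subspace W" "W \<subseteq> E" "finite W" "card W = Q ^ a"
      using that finite_subset[OF _ E(2)] by (auto simp: grass_def)
    have "core W = W"
      using card_subset_eq[OF W(3) core_subset] that(2) W(4) by simp
    then have "f ` W \<subseteq> W"
      by (auto simp: core_def)
    then have "W = {0} \<or> W = E"
      using f_simple W by blast
    then have "card W = Q ^ 0 \<or> card W = Q ^ n"
      using E(3) by (elim disjE) simp_all
    then show False
      using W(4) assms by (auto simp only: card_power_inject)
  qed
  then have "{W \<in> grass a E. card (core W) = Q ^ a} = {}"
    by blast
  then show ?thesis by (simp only: num_core_def card.empty)
qed

text \<open>\<open>Suc j\<close> is the codimension of the core in \<open>W\<close>, and the factor
  \<open>q ^ a - 1\<close> avoids division. For \<open>b < a\<close> the recurrence is a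
  unitriangular system for the numbers with first index \<open>a\<close>, with data from
  \<open>b\<close>. Summed against \<open>gauss (a - Suc j) b\<close>, both sides give
  \<open>(q ^ n - 1) * gauss a b * gauss (n - b - 1) (a - b - 1)\<close>: the closed form by
  Vandermonde, the counts by the recurrence and, for \<open>b > 0\<close>, the induction hypothesis
  at \<open>b\<close> with a second use of Vandermonde.\<close>

theorem num_core_eq:
  assumes "a < n" "j < a"
  shows "(q ^ a - 1) * of_nat (num_core a (a - Suc j)) =
    (q ^ n - 1) * q ^ (j * Suc j) * gauss a (Suc j) * gauss (n - a - 1) j"
  using assms
proof (induction a arbitrary: j rule: less_induct)
  case (less a)
  let ?F = "\<lambda>j. (q ^ n - 1) * q ^ (j * Suc j) * gauss a (Suc j) * gauss (n - a - 1) j"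
  let ?N = "\<lambda>a j. of_nat (num_core a (a - Suc j)) :: 'b"
  have shift: "(\<Sum>c\<le>b. of_nat (num_core b c) * h c) = (\<Sum>j<b. ?N b j * h (b - Suc j))"
    if "0 < b" "b < n" for b and h :: "nat \<Rightarrow> 'b"
  proof -
    have "(\<Sum>c\<le>b. of_nat (num_core b c) * h c) = (\<Sum>c<b. of_nat (num_core b c) * h c)"
      using num_core_self[OF that] by (simp add: lessThan_Suc_atMost[symmetric])
    also have "\<dots> = (\<Sum>j<b. ?N b j * h (b - Suc j))"
      by (rule sum.nat_diff_reindex[symmetric])
    finally show ?thesis .
  qed
  have F: "(\<Sum>j<a. ?F j * gauss (a - Suc j) b) = (q ^ n - 1) * gauss a b * gauss (n - b - 1) (a - b - 1)"
    if "b < a" for b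
  proof -
    have "?F j * gauss (a - Suc j) b =
        (q ^ n - 1) * gauss a b * (q ^ (j * Suc j) * gauss (a - b) (Suc j) * gauss (n - a - 1) j)" for j
      using gauss_mult_gauss_diff[of a "Suc j" b] by (simp add: mult_ac)
    then have "(\<Sum>j<a. ?F j * gauss (a - Suc j) b) = (q ^ n - 1) * gauss a b *
        (\<Sum>j<a. q ^ (j * Suc j) * gauss (a - b) (Suc j) * gauss (n - a - 1) j)"
      by (simp only: sum_distrib_left)
    also have "(\<Sum>j<a. q ^ (j * Suc j) * gauss (a - b) (Suc j) * gauss (n - a - 1) j) =
        gauss (n - b - 1) (n - a)"
      using q_vandermonde'[of "a - b" a "n - a - 1"] less.prems that
      by (simp add: Suc_diff_Suc)
    also have "\<dots> = gauss (n - b - 1) (a - b - 1)"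
      using gauss_sym[of "a - b - 1" "n - b - 1"] less.prems that by simp
    finally show ?thesis .
  qed
  have G: "(q ^ a - 1) * (\<Sum>j<a. ?N a j * gauss (a - Suc j) b) =
      (q ^ n - 1) * gauss a b * gauss (n - b - 1) (a - b - 1)" if b: "b < a" for b
  \<comment> \<open>For \<open>b = 0\<close> the factor \<open>q ^ b - 1\<close>, cancelled in the
    other case, is 0. The recurrence then only says that the numbers add up to
    \<open>gauss n a\<close>.\<close>
  proof (cases "b = 0")
    case True
    obtain n' a' where [simp]: "n = Suc n'" "a = Suc a'"
      using less.prems b by (cases n; cases a) auto
    have "(\<Sum>j<a. ?N a j * gauss (a - Suc j) b) = gauss n a"
      using core_recurrence[of a b] shift[of a "\<lambda>c. gauss c b"] less.prems b True num_core_0 by simp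
    then show ?thesis
      using gauss_absorb[of a' n'] True by simp
  next
    case False
    let ?g = "\<lambda>k. if k \<le> a then gauss (n - k) (a - k) else 0"
    obtain a' b' where ab: "a = Suc a'" "b = Suc b'"
      using b False by (cases a; cases b) auto
    have summand: "(q ^ b - 1) * (?N b j * ?g (2 * b - (b - Suc j))) =
        (q ^ n - 1) * gauss (n - b - 1) (a - b - 1)
          * (q ^ (j * Suc j) * gauss b (Suc j) * gauss (a - b - 1) j)" if j: "j < b" for j
    proof -
      have e: "2 * b - (b - Suc j) = b + Suc j" using j by simp
      have g: "gauss (n - b - 1) j * ?g (b + Suc j) = gauss (n - b - 1) (a - b - 1) * gauss (a - b - 1) j"
      proof (cases "b + Suc j \<le> a")
        case True
        then have "gauss (n - b - 1) j * gauss (n - b - 1 - j) (a - b - 1 - j) =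
            gauss (n - b - 1) (a - b - 1) * gauss (a - b - 1) j"
          by (intro gauss_mult_gauss) simp
        with True show ?thesis by simp
      next
        case False
        then show ?thesis using b by (simp add: gauss_eq_0)
      qed
      have N: "(q ^ b - 1) * ?N b j =
          (q ^ n - 1) * q ^ (j * Suc j) * gauss b (Suc j) * gauss (n - b - 1) j"
        using less.IH[OF b _ j] less.prems b by simp
      have "(q ^ b - 1) * (?N b j * ?g (b + Suc j)) = ((q ^ b - 1) * ?N b j) * ?g (b + Suc j)"
        by (simp only: mult.assoc)
      also have "\<dots> = (q ^ n - 1) * q ^ (j * Suc j) * gauss b (Suc j)
          * (gauss (n - b - 1) j * ?g (b + Suc j))"
        unfolding N by (simp only: mult.assoc)
      also have "\<dots> = (q ^ n - 1) * gauss (n - b - 1) (a - b - 1)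
          * (q ^ (j * Suc j) * gauss b (Suc j) * gauss (a - b - 1) j)"
        unfolding g by (simp only: mult_ac)
      finally show ?thesis
        unfolding e .
    qed
    have "(q ^ b - 1) * (\<Sum>j<a. ?N a j * gauss (a - Suc j) b) =
        (\<Sum>j<b. (q ^ b - 1) * (?N b j * ?g (2 * b - (b - Suc j))))"
      using core_recurrence[of a b] shift[of a "\<lambda>c. gauss c b"] shift[of b "\<lambda>c. ?g (2 * b - c)"]
        less.prems b False by (simp only: sum_distrib_left)
    also have "\<dots> = (q ^ n - 1) * gauss (n - b - 1) (a - b - 1)
        * (\<Sum>j<b. q ^ (j * Suc j) * gauss b (Suc j) * gauss (a - b - 1) j)"
      unfolding sum_distrib_left by (intro sum.cong refl summand) simp
    also have "(\<Sum>j<b. q ^ (j * Suc j) * gauss b (Suc j) * gauss (a - b - 1) j) = gauss (a - 1) (a - b)"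
      using q_vandermonde'[of b b "a - b - 1"] b by (simp add: Suc_diff_Suc)
    also have "\<dots> = gauss (a - 1) (b - 1)"
      using gauss_sym[of "b - 1" "a - 1"] b False by (simp add: Suc_diff_Suc)
    finally have "(q ^ b - 1) * ((q ^ a - 1) * (\<Sum>j<a. ?N a j * gauss (a - Suc j) b)) =
        (q ^ n - 1) * gauss (n - b - 1) (a - b - 1) * ((q ^ a - 1) * gauss (a - 1) (b - 1))"
      by (simp only: mult_ac)
    also have "(q ^ a - 1) * gauss (a - 1) (b - 1) = (q ^ b - 1) * gauss a b"
      using gauss_absorb[of b' a'] ab by simp
    finally have "(q ^ b - 1) * ((q ^ a - 1) * (\<Sum>j<a. ?N a j * gauss (a - Suc j) b)) =
        (q ^ b - 1) * ((q ^ n - 1) * gauss a b * gauss (n - b - 1) (a - b - 1))"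
      by (simp only: mult_ac)
    then show ?thesis
      using q_power_neq_1[of b] False by simp
  qed
  define D where "D j = (q ^ a - 1) * ?N a j - ?F j" for j
  have D: "(\<Sum>j<a. D j * gauss (a - Suc j) b) = 0" if "b < a" for b
    using F[OF that] G[OF that]
    unfolding D_def left_diff_distrib sum_subtractf by (simp add: sum_distrib_left mult.assoc)
  \<comment> \<open>The matrix \<open>gauss (a - Suc j) (a - Suc i)\<close> is unitriangular.\<close>
  have "D j = 0" if "j < a" for j
    using that
  proof (induction j rule: less_induct)
    case (less j)
    have "(\<Sum>i<a. D i * gauss (a - Suc i) (a - Suc j)) = (\<Sum>i\<in>{j}. D i * gauss (a - Suc i) (a - Suc j))"
    proof (rule sum.mono_neutral_right)
      show "\<forall>i\<in>{..<a} - {j}. D i * gauss (a - Suc i) (a - Suc j) = 0"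
      proof
        fix i assume i: "i \<in> {..<a} - {j}"
        show "D i * gauss (a - Suc i) (a - Suc j) = 0"
        proof (cases "i < j")
          case True
          then show ?thesis using less by simp
        next
          case False
          then have "a - Suc i < a - Suc j"
            using i less.prems by auto
          then show ?thesis by (simp add: gauss_eq_0)
        qed
      qed
    qed (use less.prems in auto)
    then show ?case
      using D[of "a - Suc j"] less.prems by simp
  qed
  then show ?case
    using less.prems by (simp add: D_def)
qed

lemma card_anti_invariant:
  "card {W \<in> grass l E. card (ssum W (f ` W)) = Q ^ (2 * l)} = num_core l 0"
proof -
  have "card (ssum W (f ` W)) = Q ^ (2 * l) \<longleftrightarrow> card (core W) = Q ^ 0" if W: "W \<in> grass l E" for W
  proof -
    from obtain_core_dim[OF W] obtain c where c: "c \<le> l" "card (core W) = Q ^ c" .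
    show ?thesis
      unfolding card_sum_image[OF W c(2,1)] c(2) card_power_inject using c(1) by auto
  qed
  then have "{W \<in> grass l E. card (ssum W (f ` W)) = Q ^ (2 * l)} = {W \<in> grass l E. card (core W) = Q ^ 0}"
    by blast
  then show ?thesis
    by (simp only: num_core_def)
qed

theorem num_core_anti_invariant:
  assumes "0 < l" "2 * l \<le> n"
  shows "of_nat (num_core l 0) = q ^ (l choose 2) * sol_coeff (n - 2 * l) l"
proof -
  have "(q ^ l - 1) * of_nat (num_core l 0) = (q ^ l - 1) * (q ^ (l choose 2) * sol_coeff (n - 2 * l) l)"
    unfolding sol_coeff_top[OF assms] using num_core_eq[of l "l - 1"] assms by simp
  then show ?thesis
    using q_power_neq_1[OF assms(1)] by simp
qed

end

section \<open>Column vectors as functions\<close>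

text \<open>Vectors of length \<open>n\<close> are modelled as functions that vanish from
  \<open>n\<close> on. All lengths then live in one additive group, as \<open>vector_space\<close>
  demands, with \<open>fspace n\<close> as a finite subspace.\<close>

definition fscale :: "'a::times \<Rightarrow> (nat \<Rightarrow> 'a) \<Rightarrow> nat \<Rightarrow> 'a" where
  "fscale c x = (\<lambda>i. c * x i)"

global_interpretation fs: finite_field_vector_space "fscale :: 'a::{field,finite} \<Rightarrow> _" "CARD('a)"
  by unfold_locales (auto simp: fscale_def algebra_simps)

definition fspace :: "nat \<Rightarrow> (nat \<Rightarrow> 'a::zero) set" where
  "fspace n = {x. \<forall>i\<ge>n. x i = 0}"

definition mat_fun :: "nat \<Rightarrow> 'a::semiring_0 mat \<Rightarrow> (nat \<Rightarrow> 'a) \<Rightarrow> nat \<Rightarrow> 'a" where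
  "mat_fun n T x = (\<lambda>i. if i < n then (\<Sum>k<n. T $$ (i, k) * x k) else 0)"

definition vec_fun :: "'a::zero vec \<Rightarrow> nat \<Rightarrow> 'a" where
  "vec_fun v = (\<lambda>i. if i < dim_vec v then v $ i else 0)"

lemma q_number_card: "q_number (of_nat CARD('a::{field,finite}) :: 'b::field_char_0)"
proof
  show "(of_nat CARD('a) :: 'b) \<noteq> 0"
    by simp
  show "(of_nat CARD('a) :: 'b) ^ k \<noteq> 1" if "0 < k" for k
  proof -
    have "CARD('a) ^ k \<noteq> CARD('a) ^ 0"
      using that by (simp only: fs.card_power_inject)
    then show ?thesis
      by (metis of_nat_1_eq_iff of_nat_power power_0)
  qed
qed

lemma counting_fscale:
  "finite_field_counting (fscale :: 'a::{field,finite} \<Rightarrow> _) CARD('a) (of_nat CARD('a) :: 'b::field_char_0)"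
  using q_number_card fs.finite_field_vector_space_axioms
  by (simp add: finite_field_counting_def finite_field_counting_axioms_def)

lemma bij_vec_fun: "bij_betw vec_fun (carrier_vec n) (fspace n)"
  by (rule bij_betw_byWitness[of _ "vec n"]) (auto simp: vec_fun_def fspace_def)

lemma vec_fun_add: "v \<in> carrier_vec n \<Longrightarrow> w \<in> carrier_vec n \<Longrightarrow> vec_fun (v + w) = vec_fun v + vec_fun w"
  for v :: "'a::monoid_add vec"
  by (rule ext) (auto simp: vec_fun_def)

lemma vec_fun_smult: "vec_fun (c \<cdot>\<^sub>v v) = fscale c (vec_fun v)" for v :: "'a::semiring_0 vec"
  by (auto simp: vec_fun_def fscale_def)

lemma vec_fun_zero: "vec_fun (0\<^sub>v n) = 0"
  by (auto simp: vec_fun_def)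

lemma vec_fun_mult_mat_vec:
  assumes "T \<in> carrier_mat n n" "v \<in> carrier_vec n"
  shows "vec_fun (T *\<^sub>v v) = mat_fun n T (vec_fun v)"
  using assms by (auto simp: vec_fun_def mat_fun_def scalar_prod_def atLeast0LessThan intro!: ext sum.cong)

lemma subspace_fspace: "fs.subspace (fspace n)"
  by (auto simp: fs.subspace_def fspace_def fscale_def)

lemma card_fspace: "finite (fspace n :: (nat \<Rightarrow> 'a::{field,finite}) set) \<and>
  card (fspace n :: (nat \<Rightarrow> 'a) set) = CARD('a) ^ n"
proof -
  have "bij_betw (\<lambda>x. restrict x {..<n}) (fspace n :: (nat \<Rightarrow> 'a) set) ({..<n} \<rightarrow>\<^sub>E UNIV)"
    by (rule bij_betw_byWitness[of _ "\<lambda>x i. if i < n then x i else 0"])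
      (auto simp: fspace_def restrict_def PiE_def extensional_def not_less)
  moreover have "finite ({..<n} \<rightarrow>\<^sub>E (UNIV :: 'a set))" "card ({..<n} \<rightarrow>\<^sub>E (UNIV :: 'a set)) = CARD('a) ^ n"
    by (auto simp: card_PiE finite_PiE)
  ultimately show ?thesis
    using bij_betw_finite bij_betw_same_card by metis
qed

lemma subspace_vec_fun:
  fixes W :: "'a::{field,finite} vec set"
  assumes W: "W \<subseteq> carrier_vec n"
  shows "VectorSpace.subspace class_ring W (module_vec TYPE('a) n) \<longleftrightarrow> fs.subspace (vec_fun ` W)"
proof -
  have inj: "x = y" if "x \<in> carrier_vec n" "y \<in> W" "vec_fun x = vec_fun y" for x y :: "'a vec"
    using that bij_betw_imp_inj_on[OF bij_vec_fun[of n]] W by (meson inj_onD subsetD)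
  have mem: "x \<in> W \<longleftrightarrow> vec_fun x \<in> vec_fun ` W" if "x \<in> carrier_vec n" for x
    using inj[OF that] by blast
  have "VectorSpace.subspace class_ring W (module_vec TYPE('a) n) \<longleftrightarrow>
      0\<^sub>v n \<in> W \<and> (\<forall>v\<in>W. \<forall>w\<in>W. v + w \<in> W) \<and> (\<forall>c. \<forall>v\<in>W. c \<cdot>\<^sub>v v \<in> W)"
    unfolding VectorSpace.subspace_def submodule_def using vec_vs[of n, where 'a = 'a] vec_module[of n, where 'a = 'a] W
    by (auto simp: module_vec_simps)
  also have "\<dots> \<longleftrightarrow> fs.subspace (vec_fun ` W)"
  proof -
    have "v + w \<in> W \<longleftrightarrow> vec_fun v + vec_fun w \<in> vec_fun ` W" if "v \<in> W" "w \<in> W" for v w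
    proof -
      have "v \<in> carrier_vec n" "w \<in> carrier_vec n" using that W by auto
      then show ?thesis using mem[of "v + w"] vec_fun_add[of v n w] by simp
    qed
    moreover have "c \<cdot>\<^sub>v v \<in> W \<longleftrightarrow> fscale c (vec_fun v) \<in> vec_fun ` W" if "v \<in> W" for c v
      using mem[of "c \<cdot>\<^sub>v v"] that W by (auto simp: vec_fun_smult)
    moreover have "0\<^sub>v n \<in> W \<longleftrightarrow> 0 \<in> vec_fun ` W"
      using mem[of "0\<^sub>v n"] by (simp add: vec_fun_zero)
    ultimately show ?thesis
      unfolding fs.subspace_def by simp
  qed
  finally show ?thesis .
qed

text \<open>The bridge from \<open>vectorspace.dim\<close> to cardinalities: coordinates with
  respect to a finite basis \<open>B\<close> identify the space with the functions from
  \<open>B\<close> to the field.\<close>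

lemma card_eq_power_dim:
  fixes V :: "('a::{field,finite}, 'c) module"
  assumes "vectorspace class_ring V" "finite (carrier V)"
  shows "card (carrier V) = CARD('a) ^ vectorspace.dim class_ring V"
proof -
  interpret vectorspace "class_ring :: 'a ring" V
    by (rule assms(1))
  have "fin_dim"
    unfolding fin_dim_def using assms(2) in_own_span[of "carrier V"] span_is_subset2[of "carrier V"]
    by (intro exI[of _ "carrier V"]) auto
  then obtain B where B: "finite B" "basis B"
    using finite_basis_exists by blast
  then have sub: "B \<subseteq> carrier V"
    by (simp add: basis_def)
  have ex1: "\<exists>!a. a \<in> B \<rightarrow>\<^sub>E UNIV \<and> lincomb a B = v" if "v \<in> carrier V" for v
    using basis_criterion[OF B(1) sub] B(2) that by (simp add: class_ring_simps)
  have "bij_betw (\<lambda>a. lincomb a B) (B \<rightarrow>\<^sub>E UNIV) (carrier V)"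
  proof (rule bij_betw_imageI)
    have cl: "lincomb a B \<in> carrier V" for a
      by (rule lincomb_closed[OF sub]) (simp add: class_ring_simps)
    show "inj_on (\<lambda>a. lincomb a B) (B \<rightarrow>\<^sub>E UNIV)"
      using ex1[OF cl] by (intro inj_onI) metis
    show "(\<lambda>a. lincomb a B) ` (B \<rightarrow>\<^sub>E UNIV) = carrier V"
      using ex1 cl by blast
  qed
  then have "card (carrier V) = card (B \<rightarrow>\<^sub>E (UNIV :: 'a set))"
    by (rule bij_betw_same_card[symmetric])
  also have "\<dots> = CARD('a) ^ card B"
    using B(1) by (simp add: card_PiE)
  also have "card B = dim"
    using dim_basis[OF B] by simp
  finally show ?thesis .
qed

lemma dim_of_eq_iff:
  fixes W :: "'a::{field,finite} vec set"
  assumes "VectorSpace.subspace class_ring W (module_vec TYPE('a) n)"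
  shows "dim_of n W = d \<longleftrightarrow> card W = CARD('a) ^ d"
proof -
  have W: "W \<subseteq> carrier_vec n"
    using assms by (auto simp: VectorSpace.subspace_def submodule_def module_vec_simps)
  have "finite (carrier_vec n :: 'a vec set)"
    using bij_betw_finite[OF bij_vec_fun] card_fspace by blast
  then have "card W = CARD('a) ^ dim_of n W"
    using card_eq_power_dim[OF vectorspace.subspace_is_vs[OF vec_vs assms]] finite_subset[OF W]
    by (simp add: dim_of_def)
  then show ?thesis
    by (metis fs.card_power_inject)
qed

lemma subspaces_carrier: "W \<in> subspaces n d \<Longrightarrow> W \<subseteq> carrier_vec n"
  by (auto simp: subspaces_def VectorSpace.subspace_def submodule_def module_vec_simps)

lemma card_image_vec_fun: "W \<subseteq> carrier_vec n \<Longrightarrow> card (vec_fun ` W) = card W"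
  using inj_on_subset[OF bij_betw_imp_inj_on[OF bij_vec_fun]] by (rule card_image)

lemma image_vec_fun_subset_iff:
  assumes "A \<subseteq> carrier_vec n" "B \<subseteq> carrier_vec n"
  shows "vec_fun ` A \<subseteq> vec_fun ` B \<longleftrightarrow> A \<subseteq> B"
  using inj_on_image_mem_iff[OF bij_betw_imp_inj_on[OF bij_vec_fun] _ assms(2)] assms(1) by blast

lemma bij_subspaces:
  "bij_betw ((`) vec_fun) (subspaces n d :: 'a::{field,finite} vec set set) (fs.grass d (fspace n))"
proof (rule bij_betw_imageI)
  show "inj_on ((`) vec_fun) (subspaces n d :: 'a vec set set)"
    using inj_on_image_eq_iff[OF bij_betw_imp_inj_on[OF bij_vec_fun] subspaces_carrier subspaces_carrier]
    by (intro inj_onI) blast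
  have im: "vec_fun ` carrier_vec n = fspace n"
    using bij_vec_fun by (rule bij_betw_imp_surj_on)
  have mem: "W \<in> subspaces n d \<longleftrightarrow> vec_fun ` W \<in> fs.grass d (fspace n)"
    if "W \<subseteq> carrier_vec n" for W :: "'a vec set"
  proof -
    have "vec_fun ` W \<subseteq> fspace n"
      using im that by blast
    then show ?thesis
      using subspace_vec_fun[OF that] dim_of_eq_iff[of W n d] card_image_vec_fun[OF that]
      by (auto simp: subspaces_def fs.grass_def)
  qed
  show "(`) vec_fun ` (subspaces n d :: 'a vec set set) = fs.grass d (fspace n)"
  proof (intro equalityI subsetI)
    fix U assume "U \<in> (`) vec_fun ` (subspaces n d :: 'a vec set set)"
    then obtain W where "W \<in> subspaces n d" "U = vec_fun ` W"
      by blast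
    then show "U \<in> fs.grass d (fspace n)"
      using mem[OF subspaces_carrier] by blast
  next
    fix U assume U: "U \<in> fs.grass d (fspace n :: (nat \<Rightarrow> 'a) set)"
    then have "U \<subseteq> vec_fun ` carrier_vec n"
      by (simp add: fs.grass_def im)
    then obtain W where W: "W \<subseteq> carrier_vec n" "U = vec_fun ` W"
      by (meson subset_imageE)
    then show "U \<in> (`) vec_fun ` (subspaces n d :: 'a vec set set)"
      using mem[OF W(1)] U by blast
  qed
qed

lemma card_subspaces_Collect:
  fixes P :: "'a::{field,finite} vec set \<Rightarrow> bool"
  assumes "\<And>W. W \<in> subspaces n d \<Longrightarrow> P W \<longleftrightarrow> R (vec_fun ` W)"
  shows "card {W \<in> subspaces n d. P W} = card {U \<in> fs.grass d (fspace n). R U}"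
proof -
  have "bij_betw ((`) vec_fun) {W \<in> subspaces n d. P W} {U \<in> fs.grass d (fspace n). R U}"
  proof (rule bij_betw_imageI)
    show "inj_on ((`) vec_fun) {W \<in> subspaces n d. P W}"
      by (rule inj_on_subset[OF bij_betw_imp_inj_on[OF bij_subspaces]]) auto
    show "(`) vec_fun ` {W \<in> subspaces n d. P W} = {U \<in> fs.grass d (fspace n). R U}"
      unfolding bij_betw_imp_surj_on[OF bij_subspaces[of n d], symmetric] using assms by auto
  qed
  then show ?thesis
    by (rule bij_betw_same_card)
qed

lemma qbinom_eq_gauss:
  "of_nat (qbinom TYPE('a::{field,finite}) (int a) (int b)) =
    (q_number.gauss (of_nat CARD('a)) a b :: 'b::field_char_0)"
proof -
  interpret finite_field_counting "fscale :: 'a \<Rightarrow> _" "CARD('a)" "of_nat CARD('a) :: 'b"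
    by (rule counting_fscale)
  have "card (subspaces a b :: 'a vec set set) = card (fs.grass b (fspace a :: (nat \<Rightarrow> 'a) set))"
    by (rule bij_betw_same_card[OF bij_subspaces])
  moreover have "of_nat (card (fs.grass b (fspace a :: (nat \<Rightarrow> 'a) set))) = gauss a b"
    using card_fspace by (intro card_grass subspace_fspace) auto
  ultimately show ?thesis
    by (simp add: qbinom_def gauss_eq_0)
qed

lemma num_invariant_eq:
  fixes T :: "'a::{field,finite} mat"
  assumes T: "T \<in> carrier_mat n n"
  shows "num_invariant n j T = card {U \<in> fs.grass j (fspace n). mat_fun n T ` U \<subseteq> U}"
  unfolding num_invariant_def
proof (rule card_subspaces_Collect)
  fix W :: "'a vec set"
  assume "W \<in> subspaces n j"
  then have W: "W \<subseteq> carrier_vec n"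
    by (rule subspaces_carrier)
  have "(\<lambda>w. T *\<^sub>v w) ` W \<subseteq> carrier_vec n"
    using T W by auto
  then have "(\<lambda>w. T *\<^sub>v w) ` W \<subseteq> W \<longleftrightarrow> vec_fun ` (\<lambda>w. T *\<^sub>v w) ` W \<subseteq> vec_fun ` W"
    using image_vec_fun_subset_iff[OF _ W] by simp
  also have "vec_fun ` (\<lambda>w. T *\<^sub>v w) ` W = mat_fun n T ` vec_fun ` W"
    unfolding image_image using vec_fun_mult_mat_vec[OF T] W by (intro image_cong) auto
  finally show "(\<lambda>w. T *\<^sub>v w) ` W \<subseteq> W \<longleftrightarrow> mat_fun n T ` vec_fun ` W \<subseteq> vec_fun ` W" .
qed

lemma mat_fun_add: "mat_fun n T (x + y) = mat_fun n T x + mat_fun n T y"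
  by (rule ext) (simp add: mat_fun_def distrib_left sum.distrib)

lemma mat_fun_fscale: "mat_fun n T (fscale c x) = fscale c (mat_fun n T x)"
  for T :: "'a::comm_semiring_0 mat"
  by (rule ext) (simp add: mat_fun_def fscale_def sum_distrib_left mult.left_commute)

lemma mat_fun_in_fspace: "mat_fun n T x \<in> fspace n"
  by (simp add: mat_fun_def fspace_def)

lemma linear_mat_fun:
  fixes T :: "'a::{field,finite} mat"
  shows "linear_operator_on fscale CARD('a) (of_nat CARD('a) :: 'b::field_char_0) (fspace n) n (mat_fun n T)"
  unfolding linear_operator_on_def linear_operator_on_axioms_def
  by (simp add: counting_fscale subspace_fspace card_fspace mat_fun_add mat_fun_fscale mat_fun_in_fspace)

lemma num_anti_invariant_eq:
  fixes T :: "'a::{field,finite} mat"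
  assumes T: "T \<in> carrier_mat n n"
  shows "num_anti_invariant n l T =
    card {U \<in> fs.grass l (fspace n). card (fs.ssum U (mat_fun n T ` U)) = CARD('a) ^ (2 * l)}"
  unfolding num_anti_invariant_def
proof (rule card_subspaces_Collect)
  \<comment> \<open>The locale asks for a field of characteristic 0, which the claim does not
    mention; \<open>rat\<close> serves.\<close>
  interpret linear_operator_on fscale "CARD('a)" "of_nat CARD('a) :: rat" "fspace n" n "mat_fun n T"
    by (rule linear_mat_fun)
  fix W :: "'a vec set"
  assume WS: "W \<in> subspaces n l"
  let ?S = "module.submodule_sum (module_vec TYPE('a) n) W ((\<lambda>w. T *\<^sub>v w) ` W)"
  have W: "W \<subseteq> carrier_vec n" "VectorSpace.subspace class_ring W (module_vec TYPE('a) n)" "dim_of n W = l"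
    using WS subspaces_carrier by (auto simp: subspaces_def)
  have TW: "(\<lambda>w. T *\<^sub>v w) ` W \<subseteq> carrier_vec n"
    using T W(1) by auto
  have S_def: "?S = {v + w | v w. v \<in> W \<and> w \<in> (\<lambda>w. T *\<^sub>v w) ` W}"
    unfolding module.submodule_sum_def[OF vec_module] by (auto simp: module_vec_simps)
  have S: "?S \<subseteq> carrier_vec n"
    unfolding S_def using subsetD[OF W(1)] subsetD[OF TW] by (blast intro: add_carrier_vec)
  have "vec_fun ` (\<lambda>w. T *\<^sub>v w) ` W = mat_fun n T ` vec_fun ` W"
    unfolding image_image using vec_fun_mult_mat_vec[OF T] W(1) by (intro image_cong) auto
  moreover have "vec_fun ` ?S = fs.ssum (vec_fun ` W) (vec_fun ` (\<lambda>w. T *\<^sub>v w) ` W)"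
  proof -
    have "vec_fun (v + w) = vec_fun v + vec_fun w" if "v \<in> W" "w \<in> (\<lambda>w. T *\<^sub>v w) ` W" for v w
      using that W(1) TW by (intro vec_fun_add) auto
    then show ?thesis
      unfolding S_def fs.ssum_def by (auto 0 4 simp: image_iff) metis+
  qed
  ultimately have im: "vec_fun ` ?S = fs.ssum (vec_fun ` W) (mat_fun n T ` vec_fun ` W)"
    by simp
  have U: "fs.subspace (vec_fun ` W)" "vec_fun ` W \<subseteq> fspace n"
    using subspace_vec_fun[OF W(1)] W bij_betw_imp_surj_on[OF bij_vec_fun] by blast+
  have "fs.subspace (vec_fun ` ?S)"
    unfolding im by (intro fs.subspace_ssum U subspace_image)
  then have "VectorSpace.subspace class_ring ?S (module_vec TYPE('a) n)"
    using subspace_vec_fun[OF S] by simp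
  then show "dim_of n ?S = 2 * dim_of n W \<longleftrightarrow>
      card (fs.ssum (vec_fun ` W) (mat_fun n T ` vec_fun ` W)) = CARD('a) ^ (2 * l)"
    unfolding im[symmetric] W(3) card_image_vec_fun[OF S] by (rule dim_of_eq_iff)
qed

section \<open>Operators with irreducible characteristic polynomial\<close>

text \<open>The characteristic matrix is again block triangular, with the characteristic matrices of
  \<open>A\<close> and \<open>D\<close> on the diagonal.\<close>

lemma char_poly_four_block_lower_left_zero:
  fixes A :: "'a::idom mat"
  assumes A: "A \<in> carrier_mat k k" and B: "B \<in> carrier_mat k m" and D: "D \<in> carrier_mat m m"
  shows "char_poly (four_block_mat A B (0\<^sub>m m k) D) = char_poly A * char_poly D"
proof -
  have "char_poly_matrix (four_block_mat A B (0\<^sub>m m k) D) =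
      four_block_mat (char_poly_matrix A) (map_mat (\<lambda>a. [:- a:]) B) (0\<^sub>m m k) (char_poly_matrix D)"
    unfolding char_poly_matrix_def
    by (rule eq_matI, insert A B D, auto simp: one_poly_def)
  then show ?thesis
    unfolding char_poly_def using A B D
    by (simp add: det_four_block_mat_lower_left_zero[of _ k _ m])
qed

lemma obtain_span_coeffs:
  fixes xs :: "(nat \<Rightarrow> 'a::{field,finite}) list"
  assumes "distinct xs" "x \<in> fs.span (set xs)"
  obtains a where "x = (\<Sum>c<length xs. fscale (a c) (xs ! c))"
proof -
  obtain u where u: "x = (\<Sum>v\<in>set xs. fscale (u v) v)"
    using assms(2) by (auto simp: fs.span_finite)
  also have "\<dots> = (\<Sum>c<length xs. fscale (u (xs ! c)) (xs ! c))"
    by (rule sum.reindex_bij_betw[OF bij_betw_nth[OF assms(1) refl refl], symmetric])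
  finally show ?thesis
    by (rule that)
qed

lemma sum_fun_apply: "(\<Sum>c\<in>C. F c) i = (\<Sum>c\<in>C. F c i)" for F :: "'c \<Rightarrow> 'd \<Rightarrow> 'e::comm_monoid_add"
  by (induction C rule: infinite_finite_induct) auto

text \<open>A basis of an invariant subspace \<open>W\<close>, extended to the whole space, brings \<open>T\<close> into
  block triangular form, so its characteristic polynomial has a factor of degree \<open>dim W\<close>.\<close>

lemma invariant_subspace_char_poly_factor:
  fixes T :: "'a::{field,finite} mat"
  assumes T: "T \<in> carrier_mat n n"
    and W: "fs.subspace W" "W \<subseteq> fspace n" "card W = CARD('a) ^ j" "mat_fun n T ` W \<subseteq> W"
  shows "\<exists>f g. char_poly T = f * g \<and> degree f = j \<and> degree g = n - j"
proof -
  have finE: "finite (fspace n :: (nat \<Rightarrow> 'a) set)" and cardE: "card (fspace n :: (nat \<Rightarrow> 'a) set) = CARD('a) ^ n"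
    using card_fspace by auto
  from fs.obtain_basis[OF W(1) finite_subset[OF W(2) finE]]
  obtain B where B: "B \<subseteq> W" "fs.independent B" "finite B" "fs.span B = W" "card W = CARD('a) ^ card B" .
  have cB: "card B = j"
    using B(5) W(3) by (simp only: fs.card_power_inject)
  have "B \<subseteq> fspace n"
    using B(1) W(2) by (rule order_trans)
  from fs.maximal_independent_subset_extend[OF this B(2)]
  obtain B' where B': "B \<subseteq> B'" "B' \<subseteq> fspace n" "fs.independent B'" "fspace n \<subseteq> fs.span B'" .
  have span: "fs.span B' = fspace n"
    using fs.span_minimal[OF B'(2) subspace_fspace] B'(4) by simp
  have finB': "finite B'"
    using finite_subset[OF B'(2) finE] .
  have cB': "card B' = n"
    using fs.card_span_independent[OF finB' B'(3)] unfolding span cardE by (simp only: fs.card_power_inject)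
  obtain ys zs where ys: "set ys = B" "distinct ys" and zs: "set zs = B' - B" "distinct zs"
    using finite_distinct_list B(3) finB' by (metis finite_Diff)
  define bs where "bs = ys @ zs"
  have bs: "set bs = B'" "distinct bs" "length bs = n" "length ys = j"
  proof -
    show "set bs = B'" "distinct bs"
      using ys zs B'(1) by (auto simp: bs_def)
    then show "length bs = n"
      using cB' distinct_card[of bs] by simp
    show "length ys = j"
      using ys cB distinct_card[of ys] by simp
  qed
  have jn: "j \<le> n"
    using bs(3,4) by (auto simp: bs_def)
  have bsE: "bs ! c \<in> fspace n" if "c < n" for c
    using bs that B'(2) by (metis nth_mem subsetD)
  have bsW: "bs ! c \<in> W" "bs ! c = ys ! c" if "c < j" for c
    using that ys bs(4) B(1) by (auto simp: bs_def nth_append)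
  define P where "P = mat n n (\<lambda>(i, c). (bs ! c) i)"
  have "\<exists>a. x = (\<Sum>c<n. fscale (a c) (bs ! c))" if "x \<in> fspace n" for x
    using obtain_span_coeffs[of bs x] bs span that by metis
  then obtain co where co: "\<And>x. x \<in> fspace n \<Longrightarrow> x = (\<Sum>c<n. fscale (co x c) (bs ! c))"
    by metis
  have "\<exists>a. x = (\<Sum>c<n. fscale (a c) (bs ! c)) \<and> (\<forall>c\<ge>j. a c = 0)" if x: "x \<in> W" for x
  proof -
    obtain a where "x = (\<Sum>c<length ys. fscale (a c) (ys ! c))"
      using obtain_span_coeffs[of ys x] ys B(4) x by metis
    also have "\<dots> = (\<Sum>c<j. fscale (if c < j then a c else 0) (bs ! c))"
      using bs(4) bsW(2) by simp
    also have "\<dots> = (\<Sum>c<n. fscale (if c < j then a c else 0) (bs ! c))"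
      using jn by (intro sum.mono_neutral_left) (auto simp: fscale_def zero_fun_def)
    finally show ?thesis
      by (intro exI[of _ "\<lambda>c. if c < j then a c else 0"]) simp
  qed
  then obtain cw where cw: "\<And>x. x \<in> W \<Longrightarrow> x = (\<Sum>c<n. fscale (cw x c) (bs ! c))"
    "\<And>x c. x \<in> W \<Longrightarrow> j \<le> c \<Longrightarrow> cw x c = 0"
    by metis
  \<comment> \<open>Column \<open>r\<close> holds coordinates of the unit vector \<open>r\<close>,
    so \<open>P * R\<close> is the identity by construction.\<close>
  define R where "R = mat n n (\<lambda>(c, r). co (\<lambda>i. if i = r then 1 else 0) c)"
  \<comment> \<open>Column \<open>c\<close> holds coordinates of the image of \<open>bs ! c\<close>.
    For \<open>c < j\<close> the image lies in \<open>W\<close>, and \<open>cw\<close> chooses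
    coordinates that vanish from \<open>j\<close> on; so the lower left block is 0 without an appeal
    to uniqueness of coordinates.\<close>
  define S where "S = mat n n (\<lambda>(c', c). (if c < j then cw else co) (mat_fun n T (bs ! c)) c')"
  have carr: "P \<in> carrier_mat n n" "R \<in> carrier_mat n n" "S \<in> carrier_mat n n"
    by (auto simp: P_def R_def S_def)
  have PR: "P * R = 1\<^sub>m n"
  proof (rule eq_matI)
    fix i r assume "i < dim_row (1\<^sub>m n :: 'a mat)" "r < dim_col (1\<^sub>m n :: 'a mat)"
    then have ir: "i < n" "r < n" by auto
    let ?e = "\<lambda>i. if i = r then 1 else 0 :: 'a"
    have "?e \<in> fspace n"
      using ir by (auto simp: fspace_def)
    from fun_cong[OF co[OF this], of i]
    have "?e i = (\<Sum>c<n. co ?e c * (bs ! c) i)"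
      by (simp add: sum_fun_apply fscale_def)
    then show "(P * R) $$ (i, r) = 1\<^sub>m n $$ (i, r)"
      using ir by (simp add: P_def R_def scalar_prod_def atLeast0LessThan mult.commute)
  qed (auto simp: P_def R_def)
  have TP: "T * P = P * S"
  proof (rule eq_matI)
    fix i c assume "i < dim_row (P * S)" "c < dim_col (P * S)"
    then have ic: "i < n" "c < n" by (auto simp: P_def S_def)
    let ?x = "mat_fun n T (bs ! c)"
    have "?x = (\<Sum>c'<n. fscale ((if c < j then cw else co) ?x c') (bs ! c'))"
      using cw(1)[of ?x] co[OF mat_fun_in_fspace, of T "bs ! c"] bsW(1)[of c] W(4) by auto
    from fun_cong[OF this, of i]
    have "?x i = (\<Sum>c'<n. (if c < j then cw else co) ?x c' * (bs ! c') i)"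
      by (simp add: sum_fun_apply fscale_def)
    then show "(T * P) $$ (i, c) = (P * S) $$ (i, c)"
      using ic T by (simp add: P_def S_def scalar_prod_def atLeast0LessThan mat_fun_def mult.commute)
  qed (use T in \<open>auto simp: P_def S_def\<close>)
  have RP: "R * P = 1\<^sub>m n"
    by (rule mat_mult_left_right_inverse[OF carr(1,2) PR])
  have "T = T * (P * R)"
    using T by (simp add: PR)
  also have "\<dots> = P * S * R"
    using T carr by (simp add: TP assoc_mult_mat[of T n n P n R n, symmetric])
  finally have "similar_mat T S"
    using similar_mat_witI[OF PR RP _ T carr(3,1,2)] unfolding similar_mat_def by blast
  then have "char_poly T = char_poly S"
    by (rule char_poly_similar)
  define A where "A = mat j j (\<lambda>(r, c). S $$ (r, c))"
  define D where "D = mat (n - j) (n - j) (\<lambda>(r, c). S $$ (r + j, c + j))"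
  define C where "C = mat j (n - j) (\<lambda>(r, c). S $$ (r, c + j))"
  have "S = four_block_mat A C (0\<^sub>m (n - j) j) D"
  proof (rule eq_matI)
    fix r c assume "r < dim_row (four_block_mat A C (0\<^sub>m (n - j) j) D)"
      "c < dim_col (four_block_mat A C (0\<^sub>m (n - j) j) D)"
    then have rc: "r < n" "c < n"
      using jn by (auto simp: A_def D_def)
    have "S $$ (r, c) = 0" if "j \<le> r" "c < j"
      using that rc cw(2)[of "mat_fun n T (bs ! c)" r] bsW(1)[of c] W(4) by (auto simp: S_def)
    then show "S $$ (r, c) = four_block_mat A C (0\<^sub>m (n - j) j) D $$ (r, c)"
      using rc jn by (auto simp: A_def C_def D_def not_less)
  qed (use jn in \<open>auto simp: S_def A_def D_def\<close>)
  then have "char_poly S = char_poly A * char_poly D"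
    using char_poly_four_block_lower_left_zero[of A j C "n - j" D] by (simp add: A_def C_def D_def)
  moreover have "degree (char_poly A) = j" "degree (char_poly D) = n - j"
    using degree_monic_char_poly[of A j] degree_monic_char_poly[of D "n - j"] by (simp_all add: A_def D_def)
  ultimately show ?thesis
    using \<open>char_poly T = char_poly S\<close> by auto
qed

text \<open>An invariant subspace of dimension \<open>j\<close> splits the characteristic polynomial
  into factors of degrees \<open>j\<close> and \<open>n - j\<close>, one of which must be a
  unit.\<close>

lemma irreducible_char_poly_simple:
  fixes T :: "'a::{field,finite} mat"
  assumes T: "T \<in> carrier_mat n n" "irreducible (char_poly T)"
    and W: "fs.subspace W" "W \<subseteq> fspace n" "mat_fun n T ` W \<subseteq> W"
  shows "W = {0} \<or> W = fspace n"
proof -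
  have finE: "finite (fspace n :: (nat \<Rightarrow> 'a) set)" and cardE: "card (fspace n :: (nat \<Rightarrow> 'a) set) = CARD('a) ^ n"
    using card_fspace by auto
  have finW: "finite W"
    using finite_subset[OF W(2) finE] .
  from fs.obtain_dim[OF W(1) finW] obtain j where j: "card W = CARD('a) ^ j" .
  obtain f g where fg: "char_poly T = f * g" "degree f = j" "degree g = n - j"
    using invariant_subspace_char_poly_factor[OF T(1) W(1,2) j W(3)] by blast
  have "f dvd 1 \<or> g dvd 1"
    using irreducibleD[OF T(2) fg(1)] .
  then have "j = 0 \<or> n - j = 0"
    using fg(2,3) by (auto simp: poly_dvd_1)
  moreover have "j \<le> n"
    using card_mono[OF finE W(2)] by (simp only: j cardE fs.card_power_le_iff)
  ultimately have "j = 0 \<or> j = n" by auto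
  then show ?thesis
  proof
    assume "j = 0"
    then have "card W = 1" using j by simp
    then show ?thesis
      using fs.subspace_0[OF W(1)] by (metis card_1_singletonE singletonD)
  next
    assume "j = n"
    then show ?thesis
      using card_subset_eq[OF finE W(2)] j cardE by simp
  qed
qed

text \<open>The kernel is invariant, hence \<open>{0}\<close> or everything. In the latter case
  every line would be invariant, impossible for \<open>n \<ge> 2\<close>. For \<open>n = 1\<close>
  injectivity can fail: the zero matrix has the irreducible characteristic polynomial X.\<close>

lemma irreducible_simple_operator:
  fixes T :: "'a::{field,finite} mat"
  assumes T: "T \<in> carrier_mat n n" "irreducible (char_poly T)" and n: "2 \<le> n"
  shows "simple_operator fscale CARD('a) (of_nat CARD('a) :: 'b::field_char_0) (fspace n) n (mat_fun n T)"
proof -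
  interpret linear_operator_on fscale "CARD('a)" "of_nat CARD('a) :: 'b" "fspace n" n "mat_fun n T"
    by (rule linear_mat_fun)
  let ?f = "mat_fun n T"
  let ?K = "{x \<in> fspace n. ?f x = 0}"
  have K_sub: "fs.subspace ?K"
    using subspace_fspace[of n, where 'a = 'a] f_0
    by (auto simp: fs.subspace_def mat_fun_add mat_fun_fscale)
  have "?f ` ?K \<subseteq> ?K"
    using f_0 fs.subspace_0[OF subspace_fspace] by auto
  then consider "?K = {0}" | "?K = fspace n"
    using irreducible_char_poly_simple[OF T K_sub] by blast
  then have "inj_on ?f (fspace n)"
  proof cases
    case 1
    show ?thesis
    proof (rule inj_onI)
      fix x y assume xy: "x \<in> fspace n" "y \<in> fspace n" "?f x = ?f y"
      have "?f (x - y) + ?f y = ?f x"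
        using mat_fun_add[of n T "x - y" y] by simp
      then have "x - y \<in> ?K"
        using xy fs.subspace_diff[OF subspace_fspace] by simp
      then show "x = y"
        using 1 by auto
    qed
  next
    case 2
    have "card (fspace n :: (nat \<Rightarrow> 'a) set) \<noteq> CARD('a) ^ 0"
      unfolding card_fspace[THEN conjunct2] fs.card_power_inject using n by simp
    then have "fspace n \<noteq> {0 :: nat \<Rightarrow> 'a}"
      by auto
    then obtain x :: "nat \<Rightarrow> 'a" where x: "x \<in> fspace n" "x \<noteq> 0"
      using fs.subspace_0[OF subspace_fspace] by blast
    have sub: "fs.span {x} \<subseteq> fspace n"
      using x(1) subspace_fspace by (intro fs.span_minimal) auto
    have "?f y = 0" if "y \<in> fs.span {x}" for y
      using that sub 2 by blast
    then have "?f ` fs.span {x} \<subseteq> fs.span {x}"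
      using fs.span_zero by auto
    then consider "fs.span {x} = {0}" | "fs.span {x} = fspace n"
      using irreducible_char_poly_simple[OF T fs.subspace_span sub] by blast
    then show ?thesis
    proof cases
      case 1
      then show ?thesis
        using x(2) fs.span_base[of x "{x}"] by simp
    next
      case 2
      have "card (fs.span {x}) = CARD('a) ^ 1"
        using fs.card_span_independent[of "{x}"] x(2) by simp
      then have "n = 1"
        unfolding 2 card_fspace[THEN conjunct2] fs.card_power_inject .
      with n show ?thesis by simp
    qed
  qed
  then show ?thesis
    using irreducible_char_poly_simple[OF T] linear_operator_on_axioms
    by (simp add: simple_operator_def simple_operator_axioms_def)
qed

section \<open>Invariant and anti-invariant subspaces of the given matrices\<close>

lemma mat_fun_mult:
  assumes "A \<in> carrier_mat n n" "B \<in> carrier_mat n n"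
  shows "mat_fun n (A * B) x = mat_fun n A (mat_fun n B x)"
proof (rule ext)
  fix i
  show "mat_fun n (A * B) x i = mat_fun n A (mat_fun n B x) i"
  proof (cases "i < n")
    case True
    have "mat_fun n (A * B) x i = (\<Sum>k<n. (\<Sum>j<n. A $$ (i, j) * B $$ (j, k)) * x k)"
      using assms True by (simp add: mat_fun_def scalar_prod_def atLeast0LessThan)
    also have "\<dots> = (\<Sum>j<n. A $$ (i, j) * (\<Sum>k<n. B $$ (j, k) * x k))"
      unfolding sum_distrib_right sum_distrib_left by (subst sum.swap) (simp add: mult.assoc)
    also have "\<dots> = mat_fun n A (mat_fun n B x) i"
      using True by (simp add: mat_fun_def)
    finally show ?thesis .
  qed (simp add: mat_fun_def)
qed

lemma mat_fun_one: "x \<in> fspace n \<Longrightarrow> mat_fun n (1\<^sub>m n) x = x" for x :: "nat \<Rightarrow> 'a::semiring_1"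
proof (rule ext)
  fix i assume x: "x \<in> fspace n"
  have "(\<Sum>k<n. 1\<^sub>m n $$ (i, k) * x k) = (\<Sum>k\<in>{i}. 1\<^sub>m n $$ (i, k) * x k)" if "i < n"
    using that by (intro sum.mono_neutral_right) auto
  then show "mat_fun n (1\<^sub>m n) x i = x i"
    using x by (auto simp: mat_fun_def fspace_def)
qed

section \<open>Matrices with one nonsingular irreducible block\<close>

locale zero_block_mat =
  fixes m e :: nat and T' T :: "'a::{field,finite} mat"
  assumes T': "T' \<in> carrier_mat e e" "invertible_mat T'" "irreducible (char_poly T')"
    and e: "0 < e"
    and T: "T = four_block_mat (0\<^sub>m m m) (0\<^sub>m m e) (0\<^sub>m e m) T'"
begin

text \<open>The operator acts through the last \<open>e\<close> coordinates. \<open>unshift\<close>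
  embeds \<open>fspace e\<close> as its image, where \<open>shift\<close> is the inverse and turns
  the operator into \<open>T'\<close>.\<close>

definition shift :: "(nat \<Rightarrow> 'a) \<Rightarrow> nat \<Rightarrow> 'a" where
  "shift x = (\<lambda>i. x (m + i))"

definition unshift :: "(nat \<Rightarrow> 'a) \<Rightarrow> nat \<Rightarrow> 'a" where
  "unshift y = (\<lambda>i. if m \<le> i then y (i - m) else 0)"

abbreviation f :: "(nat \<Rightarrow> 'a) \<Rightarrow> nat \<Rightarrow> 'a" where
  "f \<equiv> mat_fun (m + e) T"

abbreviation img :: "(nat \<Rightarrow> 'a) set" where
  "img \<equiv> unshift ` fspace e"

lemma T_carrier: "T \<in> carrier_mat (m + e) (m + e)"
  using T'(1) unfolding T by (intro four_block_carrier_mat) auto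

lemma shift_unshift [simp]: "shift (unshift y) = y"
  by (simp add: shift_def unshift_def)

lemma shift_add: "shift (x + y) = shift x + shift y"
  by (rule ext) (simp add: shift_def)

lemma shift_scale: "shift (fscale c x) = fscale c (shift x)"
  by (simp add: shift_def fscale_def)

lemma shift_zero: "shift 0 = 0"
  by (rule ext) (simp add: shift_def)

lemma shift_fspace: "x \<in> fspace (m + e) \<Longrightarrow> shift x \<in> fspace e"
  by (simp add: shift_def fspace_def)

lemma unshift_fspace: "img \<subseteq> fspace (m + e)"
  by (auto simp: unshift_def fspace_def)

lemma T_index:
  assumes "i < m + e" "k < m + e"
  shows "T $$ (i, k) = (if m \<le> i \<and> m \<le> k then T' $$ (i - m, k - m) else 0)"
  using assms T'(1) unfolding T by (auto simp: not_le)

lemma f_eq: "f x = unshift (mat_fun e T' (shift x))"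
proof (rule ext)
  fix i
  show "f x i = unshift (mat_fun e T' (shift x)) i"
  proof (cases "m \<le> i \<and> i < m + e")
    case True
    have "(\<Sum>k<m + e. T $$ (i, k) * x k) = (\<Sum>k\<in>{m..<m + e}. T' $$ (i - m, k - m) * x k)"
      using True by (intro sum.mono_neutral_cong_right) (auto simp: T_index)
    also have "\<dots> = (\<Sum>k<e. T' $$ (i - m, k) * x (m + k))"
      by (intro sum.reindex_bij_witness[of _ "\<lambda>k. m + k" "\<lambda>k. k - m"]) auto
    finally show ?thesis
      using True by (auto simp: mat_fun_def unshift_def shift_def)
  next
    case False
    then show ?thesis
      by (auto simp: mat_fun_def unshift_def T_index intro!: sum.neutral)
  qed
qed

lemma obtain_inverse:
  obtains B where "B \<in> carrier_mat e e" "T' * B = 1\<^sub>m e" "B * T' = 1\<^sub>m e"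
proof -
  obtain B where B: "T' * B = 1\<^sub>m (dim_row T')" "B * T' = 1\<^sub>m (dim_row B)"
    using T'(2) unfolding invertible_mat_def inverts_mat_def by blast
  have "dim_col B = e" "dim_row B = e"
    using arg_cong[OF B(1), of dim_col] arg_cong[OF B(2), of dim_col] T'(1) by auto
  then have "B \<in> carrier_mat e e" by auto
  then show ?thesis
    using that[of B] B T'(1) by auto
qed

lemma inj_T': "inj_on (mat_fun e T') (fspace e)"
proof -
  obtain B where B: "B \<in> carrier_mat e e" "T' * B = 1\<^sub>m e" "B * T' = 1\<^sub>m e"
    by (rule obtain_inverse)
  have "mat_fun e B (mat_fun e T' x) = x" if "x \<in> fspace e" for x
    using mat_fun_mult[OF B(1) T'(1), of x] B(3) mat_fun_one[OF that] by simp
  then show ?thesis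
    by (intro inj_on_inverseI[of _ "mat_fun e B"])
qed

lemma mat_fun_zero: "mat_fun e T' 0 = 0"
  by (rule ext) (simp add: mat_fun_def)

lemma unshift_zero: "unshift 0 = 0"
  by (rule ext) (simp add: unshift_def)

lemma f_image: "f ` fspace (m + e) = img"
proof (intro equalityI subsetI)
  fix y assume "y \<in> f ` fspace (m + e)"
  then show "y \<in> img"
    using f_eq mat_fun_in_fspace by blast
next
  fix y assume "y \<in> img"
  then obtain z where z: "z \<in> fspace e" "y = unshift z" by blast
  obtain B where B: "B \<in> carrier_mat e e" "T' * B = 1\<^sub>m e" "B * T' = 1\<^sub>m e"
    by (rule obtain_inverse)
  have "f (unshift (mat_fun e B z)) = unshift (mat_fun e (T' * B) z)"
    by (simp add: f_eq mat_fun_mult[OF T'(1) B(1)])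
  then have "y = f (unshift (mat_fun e B z))"
    using z(2) B(2) mat_fun_one[OF z(1)] by simp
  moreover have "unshift (mat_fun e B z) \<in> fspace (m + e)"
    using unshift_fspace mat_fun_in_fspace by blast
  ultimately show "y \<in> f ` fspace (m + e)"
    by blast
qed

lemma card_img: "finite img" "card img = CARD('a) ^ e"
proof -
  have "inj_on unshift (fspace e)"
    by (rule inj_on_inverseI[of _ shift]) simp
  then show "card img = CARD('a) ^ e"
    using card_fspace[of e, where 'a = 'a] by (simp add: card_image)
  show "finite img"
    using card_fspace[of e, where 'a = 'a] by simp
qed

lemma f_eq_0_iff:
  assumes "x \<in> fspace (m + e)"
  shows "f x = 0 \<longleftrightarrow> x \<in> fspace m"
proof -
  have "f x = 0 \<longleftrightarrow> mat_fun e T' (shift x) = 0"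
    using f_eq shift_unshift shift_zero unshift_zero by metis
  also have "\<dots> \<longleftrightarrow> shift x = 0"
    using inj_onD[OF inj_T', of "shift x" 0] shift_fspace[OF assms] mat_fun_zero
      fs.subspace_0[OF subspace_fspace] by auto
  also have "\<dots> \<longleftrightarrow> x \<in> fspace m"
  proof
    assume s: "shift x = 0"
    have "x i = 0" if "m \<le> i" for i
      using fun_cong[OF s, of "i - m"] that by (simp add: shift_def)
    then show "x \<in> fspace m"
      by (simp add: fspace_def)
  qed (auto simp: shift_def fspace_def)
  finally show ?thesis .
qed

lemma inj_on_img: "inj_on f img"
proof (rule inj_onI)
  fix x y assume "x \<in> img" "y \<in> img" and eq: "f x = f y"
  then obtain u v where u: "u \<in> fspace e" "x = unshift u" and v: "v \<in> fspace e" "y = unshift v"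
    by blast
  have "mat_fun e T' u = mat_fun e T' v"
    using arg_cong[OF eq, of shift] u v by (simp add: f_eq)
  then show "x = y"
    using inj_onD[OF inj_T'] u v by blast
qed

lemma img_simple:
  assumes U: "fs.subspace U" "U \<subseteq> img" "f ` U \<subseteq> U"
  shows "U = {0} \<or> U = img"
proof -
  have recover: "unshift ` shift ` U = U"
  proof -
    have "unshift (shift x) = x" if "x \<in> U" for x
      using that U(2) by auto
    then show ?thesis
      by (simp add: image_image)
  qed
  have "fs.subspace (shift ` U)"
    unfolding fs.subspace_def
  proof (intro conjI ballI allI)
    show "0 \<in> shift ` U"
      using fs.subspace_0[OF U(1)] shift_zero by (metis imageI)
    fix x assume "x \<in> shift ` U"
    then obtain a where a: "a \<in> U" "x = shift a" by blast
    show "fscale c x \<in> shift ` U" for c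
      using fs.subspace_scale[OF U(1) a(1), of c] shift_scale[of c a] a(2) by (metis imageI)
    fix y assume "y \<in> shift ` U"
    then obtain b where b: "b \<in> U" "y = shift b" by blast
    show "x + y \<in> shift ` U"
      using fs.subspace_add[OF U(1) a(1) b(1)] shift_add[of a b] a(2) b(2) by (metis imageI)
  qed
  moreover have "shift ` U \<subseteq> fspace e"
    using U(2) by auto
  moreover have "mat_fun e T' ` shift ` U \<subseteq> shift ` U"
  proof -
    have "mat_fun e T' (shift x) = shift (f x)" for x
      by (simp add: f_eq)
    then show ?thesis
      using U(3) by auto
  qed
  ultimately have "shift ` U = {0} \<or> shift ` U = fspace e"
    by (rule irreducible_char_poly_simple[OF T'(1,3)])
  then show ?thesis
    using recover unshift_zero by (elim disjE) (metis image_empty image_insert, metis)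
qed

lemma num_invariant_zero_block:
  "of_nat (num_invariant (m + e) j T) =
    q_number.gauss (of_nat CARD('a) :: 'b::field_char_0) m j
    + (if e \<le> j then q_number.gauss (of_nat CARD('a)) m (j - e) else 0)"
proof -
  interpret linear_operator_on fscale "CARD('a)" "of_nat CARD('a) :: 'b" "fspace (m + e)" "m + e" f
    by (rule linear_mat_fun)
  have "fspace m \<subseteq> (fspace (m + e) :: (nat \<Rightarrow> 'a) set)"
    by (auto simp: fspace_def)
  from card_invariant[OF subspace_fspace this conjunct2[OF card_fspace] f_eq_0_iff f_image card_img(2) e inj_on_img img_simple, of j]
  show ?thesis
    unfolding num_invariant_eq[OF T_carrier] by simp
qed

lemma num_anti_invariant_zero_block:
  assumes "e < l"
  shows "num_anti_invariant (m + e) l T = 0"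
proof -
  interpret linear_operator_on fscale "CARD('a)" "of_nat CARD('a) :: rat" "fspace (m + e)" "m + e" f
    by (rule linear_mat_fun)
  show ?thesis
    unfolding num_anti_invariant_eq[OF T_carrier]
      no_anti_invariant[OF eq_refl[OF f_image] card_img assms] by simp
qed

end

lemma mat_fun_zero_mat: "mat_fun n (0\<^sub>m n n) x = 0"
  by (rule ext) (simp add: mat_fun_def)

lemma num_invariant_zero_mat:
  "of_nat (num_invariant n j (0\<^sub>m n n :: 'a::{field,finite} mat)) =
    (q_number.gauss (of_nat CARD('a)) n j :: 'b::field_char_0)"
proof -
  interpret linear_operator_on fscale "CARD('a)" "of_nat CARD('a) :: 'b" "fspace n" n "mat_fun n (0\<^sub>m n n :: 'a mat)"
    by (rule linear_mat_fun)
  have "mat_fun n (0\<^sub>m n n) ` U \<subseteq> U" if "U \<in> fs.grass j (fspace n)" for U :: "(nat \<Rightarrow> 'a) set"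
    using that fs.subspace_0[of U] by (auto simp: mat_fun_zero_mat fs.grass_def)
  then have "{U \<in> fs.grass j (fspace n). mat_fun n (0\<^sub>m n n) ` U \<subseteq> U} = fs.grass j (fspace n :: (nat \<Rightarrow> 'a) set)"
    by blast
  then show ?thesis
    unfolding num_invariant_eq[OF zero_carrier_mat] using card_grass[OF E] by simp
qed

lemma num_anti_invariant_zero_mat:
  assumes "0 < l"
  shows "num_anti_invariant n l (0\<^sub>m n n :: 'a::{field,finite} mat) = 0"
proof -
  interpret linear_operator_on fscale "CARD('a)" "of_nat CARD('a) :: rat" "fspace n" n "mat_fun n (0\<^sub>m n n :: 'a mat)"
    by (rule linear_mat_fun)
  have im: "mat_fun n (0\<^sub>m n n) ` fspace n \<subseteq> {0 :: nat \<Rightarrow> 'a}"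
    by (auto simp: mat_fun_zero_mat)
  have zero: "finite {0 :: nat \<Rightarrow> 'a}" "card {0 :: nat \<Rightarrow> 'a} = CARD('a) ^ 0"
    by simp_all
  show ?thesis
    unfolding num_anti_invariant_eq[OF zero_carrier_mat] no_anti_invariant[OF im zero assms] by simp
qed

text \<open>The characteristic polynomial of an empty matrix is 1, a unit. This keeps
  \<open>j = 0\<close> and \<open>j = n\<close> apart in the count of invariant subspaces.\<close>

lemma degree_char_poly_pos:
  assumes "T \<in> carrier_mat n n" "irreducible (char_poly (T :: 'a::field mat))"
  shows "0 < n"
proof (rule ccontr)
  assume "\<not> 0 < n"
  then have d: "degree (char_poly T) = 0" "coeff (char_poly T) 0 = 1"
    using degree_monic_char_poly[OF assms(1)] by auto
  then have "char_poly T = 1"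
    by (metis degree_0_id one_pCons of_nat_1)
  then show False
    using assms(2) by (simp add: irreducible_def)
qed

lemma num_invariant_irreducible:
  fixes T :: "'a::{field,finite} mat"
  assumes T: "T \<in> carrier_mat n n" "irreducible (char_poly T)"
  shows "num_invariant n j T = of_bool (j = 0) + of_bool (j = n)"
proof -
  interpret linear_operator_on fscale "CARD('a)" "of_nat CARD('a) :: rat" "fspace n" n "mat_fun n T"
    by (rule linear_mat_fun)
  show ?thesis
    unfolding num_invariant_eq[OF T(1)]
    by (rule card_invariant_simple[OF degree_char_poly_pos[OF T] irreducible_char_poly_simple[OF T]])
qed

lemma num_anti_invariant_irreducible:
  fixes T :: "'a::{field,finite} mat"
  assumes T: "T \<in> carrier_mat n n" "irreducible (char_poly T)" and n: "2 * l \<le> n"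
  shows "of_nat (num_anti_invariant n l T) =
    (of_nat CARD('a) ^ (l choose 2) * q_number.sol_coeff (of_nat CARD('a)) (n - 2 * l) l :: 'b::field_char_0)"
\<comment> \<open>For \<open>l = 0\<close> the dimension \<open>n\<close> may be 1, where the
  operator need not be injective; the zero subspace is counted directly.\<close>
proof (cases "l = 0")
  case True
  interpret linear_operator_on fscale "CARD('a)" "of_nat CARD('a) :: 'b" "fspace n" n "mat_fun n T"
    by (rule linear_mat_fun)
  show ?thesis
    unfolding num_anti_invariant_eq[OF T(1)] True card_anti_invariant_0 by (simp add: numeral_2_eq_2)
next
  case False
  then have "2 \<le> n" using n by simp
  interpret simple_operator fscale "CARD('a)" "of_nat CARD('a) :: 'b" "fspace n" n "mat_fun n T"
    by (rule irreducible_simple_operator[OF T \<open>2 \<le> n\<close>])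
  show ?thesis
    unfolding num_anti_invariant_eq[OF T(1)] card_anti_invariant
    using num_core_anti_invariant[of l] False n by simp
qed

section \<open>The system in terms of Gaussian binomials\<close>

lemma X_coeff_eq:
  assumes "2 * l \<le> n" "i \<le> l" "j \<le> l" "0 < l"
  shows "of_nat (X_coeff TYPE('a::{field,finite}) n l i j) =
    (q_number.coeff_matrix (of_nat CARD('a)) n l i j :: 'b::field_char_0)"
proof -
  interpret q_number "of_nat CARD('a) :: 'b"
    by (rule q_number_card)
  define N where "N = n - l + i"
  have N: "int n - int l + int i = int N"
    using assms by (simp add: N_def)
  define r where "r = (if l - i \<le> j then qbinom TYPE('a) (int N) (int (j - (l - i))) else 0)"
  have r: "qbinom TYPE('a) (int N) (int j - int l + int i) = r"
  proof (cases "l - i \<le> j")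
    case True
    then have "int j - int l + int i = int (j - (l - i))"
      using assms by simp
    then show ?thesis
      by (simp only: True if_True r_def)
  next
    case False
    then have "int j - int l + int i < 0"
      using assms by linarith
    then show ?thesis
      using False by (simp add: qbinom_def r_def)
  qed
  consider "i = 0" | "0 < i" "i < l" | "i = l" "0 < i"
    using assms by linarith
  then show ?thesis
  proof cases
    case 1
    then show ?thesis
      using assms by (simp add: X_coeff_def coeff_matrix_def)
  next
    case 2
    have "X_coeff TYPE('a) n l i j = qbinom TYPE('a) (int N) (int j) + r"
      using 2 by (simp only: X_coeff_def N r) simp
    moreover have "of_nat r = (if l - i \<le> j then gauss N (j - (l - i)) else 0)"
      by (cases "l - i \<le> j") (simp_all only: r_def if_True if_False qbinom_eq_gauss of_nat_0)
    ultimately show ?thesis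
      using 2 by (simp add: coeff_matrix_def qbinom_eq_gauss flip: N_def)
  next
    case 3
    then show ?thesis
      by (simp add: X_coeff_def coeff_matrix_def qbinom_eq_gauss)
  qed
qed

lemma sol_coeff_eq:
  assumes "2 * l \<le> n" "j \<le> l"
  shows "of_nat (qbinom TYPE('a::{field,finite}) (int n - int l - int j) (int n - 2 * int l)) *
      of_nat CARD('a) ^ ((l - j + 1) choose 2) +
    of_nat (qbinom TYPE('a) (int n - int l - int j - 1) (int n - 2 * int l)) *
      of_nat CARD('a) ^ ((l - j) choose 2) =
    (q_number.sol_coeff (of_nat CARD('a)) (n - 2 * l) (l - j) :: 'b::field_char_0)"
proof -
  interpret q_number "of_nat CARD('a) :: 'b"
    by (rule q_number_card)
  have ix: "int n - int l - int j = int (n - 2 * l + (l - j))" "int n - 2 * int l = int (n - 2 * l)"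
    using assms by simp_all
  show ?thesis
  proof (cases "j = l")
    \<comment> \<open>For \<open>j = l\<close> the second binomial has upper index
      \<open>n - 2 * l - 1\<close>, one below its lower index and possibly negative, so it is
      0.\<close>
    case True
    then show ?thesis
      unfolding ix by (simp add: qbinom_eq_gauss sol_coeff_def) (simp add: qbinom_def)
  next
    case False
    then have e: "int (n - 2 * l + (l - j)) - 1 = int (n - 2 * l + (l - j) - 1)" and "l - j \<noteq> 0"
      using assms(2) by simp_all
    then show ?thesis
      unfolding ix e qbinom_eq_gauss sol_coeff_def by (simp add: mult.commute)
  qed
qed

theorem theorem4p1:
  fixes T :: "nat \<Rightarrow> 'a::{field,finite} mat" and n l q :: nat
  assumes "q = CARD('a)"
    and "n \<ge> 2 * l"
    and "T 0 \<in> carrier_mat n n" and "irreducible (char_poly (T 0))"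
    and "\<And>i. 1 \<le> i \<Longrightarrow> i < l \<Longrightarrow>
           \<exists>T' \<in> carrier_mat (l - i) (l - i).
             invertible_mat T' \<and> irreducible (char_poly T') \<and>
             T i = four_block_mat (0\<^sub>m (n - l + i) (n - l + i)) (0\<^sub>m (n - l + i) (l - i))
                                  (0\<^sub>m (l - i) (n - l + i)) T'"
    and "1 \<le> l \<Longrightarrow> T l = 0\<^sub>m n n"
  shows "(\<forall>i\<le>l. \<forall>j\<le>l. X_coeff TYPE('a) n l i j = num_invariant n j (T i)) \<and>
    (\<forall>p :: nat \<Rightarrow> 'b::field_char_0.
       (\<forall>i\<le>l. of_nat (num_anti_invariant n l (T i)) =
                (\<Sum>j=0..l. p j * of_nat (X_coeff TYPE('a) n l i j)))
       \<longleftrightarrow>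
       (\<forall>j\<le>l. p j = (-1) ^ j * of_nat q ^ (l choose 2) *
          (of_nat (qbinom TYPE('a) (int n - int l - int j) (int n - 2 * int l)) *
             of_nat q ^ ((l - j + 1) choose 2) +
           of_nat (qbinom TYPE('a) (int n - int l - int j - 1) (int n - 2 * int l)) *
             of_nat q ^ ((l - j) choose 2))))"
proof -
  let ?q = "of_nat CARD('a) :: 'b"
  interpret q_number ?q
    by (rule q_number_card)
  have T_block: "of_nat (num_invariant n j (T i)) = gauss (n - l + i) j
        + (if l - i \<le> j then gauss (n - l + i) (j - (l - i)) else 0)"
      "num_anti_invariant n l (T i) = 0" if i: "0 < i" "i < l" for i j
  proof -
    obtain T' where T': "T' \<in> carrier_mat (l - i) (l - i)" "invertible_mat T'" "irreducible (char_poly T')"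
        "T i = four_block_mat (0\<^sub>m (n - l + i) (n - l + i)) (0\<^sub>m (n - l + i) (l - i))
                 (0\<^sub>m (l - i) (n - l + i)) T'"
      using assms(5)[of i] i by auto
    interpret zero_block_mat "n - l + i" "l - i" T' "T i"
      by unfold_locales (use T' i in auto)
    have n: "n - l + i + (l - i) = n"
      using i assms(2) by simp
    show "of_nat (num_invariant n j (T i)) = gauss (n - l + i) j
        + (if l - i \<le> j then gauss (n - l + i) (j - (l - i)) else 0)"
      using num_invariant_zero_block[of j, where 'b = 'b] unfolding n .
    show "num_anti_invariant n l (T i) = 0"
      using num_anti_invariant_zero_block[of l] i unfolding n by simp
  qed
  have X: "X_coeff TYPE('a) n l i j = num_invariant n j (T i)" if ij: "i \<le> l" "j \<le> l" for i j
  proof (cases "i = 0")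
    case True
    then show ?thesis
      using num_invariant_irreducible[OF assms(3,4), of j] by (simp add: X_coeff_def)
  next
    case False
    \<comment> \<open>The comparison takes place in \<open>'b\<close>, where both sides are
      expressions in \<open>gauss\<close>; characteristic 0 brings it back to the naturals.\<close>
    then have "of_nat (X_coeff TYPE('a) n l i j) = coeff_matrix n l i j"
      using X_coeff_eq[of l n i j, where 'a = 'a and 'b = 'b] ij assms(2) by simp
    also have "\<dots> = of_nat (num_invariant n j (T i))"
    proof (cases "i = l")
      case True
      then show ?thesis
        using False assms(6) num_invariant_zero_mat[of n j, where 'a = 'a and 'b = 'b]
        by (simp add: coeff_matrix_def)
    next
      case ne: False
      then show ?thesis
        using T_block(1)[of i j] False ij(1) by (simp add: coeff_matrix_def)
    qed
    finally show ?thesis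
      by simp
  qed
  define p0 where "p0 j = (-1) ^ j * ?q ^ (l choose 2) * sol_coeff (n - 2 * l) (l - j)" for j
  have p0_eq: "(-1) ^ j * of_nat q ^ (l choose 2) *
          (of_nat (qbinom TYPE('a) (int n - int l - int j) (int n - 2 * int l)) *
             of_nat q ^ ((l - j + 1) choose 2) +
           of_nat (qbinom TYPE('a) (int n - int l - int j - 1) (int n - 2 * int l)) *
             of_nat q ^ ((l - j) choose 2)) = p0 j" if "j \<le> l" for j
    unfolding assms(1) sol_coeff_eq[OF assms(2) that] p0_def ..
  have alpha_0: "of_nat (num_anti_invariant n l (T 0)) = p0 0"
    unfolding num_anti_invariant_irreducible[OF assms(3,4,2)] by (simp add: p0_def)
  have "(\<forall>i\<le>l. of_nat (num_anti_invariant n l (T i)) = (\<Sum>j=0..l. p j * of_nat (X_coeff TYPE('a) n l i j)))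
      \<longleftrightarrow> (\<forall>j\<le>l. p j = p0 j)" for p :: "nat \<Rightarrow> 'b"
  proof (cases "l = 0")
    case True
    \<comment> \<open>The system is a single equation here. At \<open>n = 0\<close> its coefficient
      would be 2 instead of 1.\<close>
    have "n \<noteq> 0"
      using degree_char_poly_pos[OF assms(3,4)] by simp
    then show ?thesis
      using True alpha_0 by (auto simp: X_coeff_def)
  next
    case False
    have X': "(\<Sum>j=0..l. u j * of_nat (X_coeff TYPE('a) n l i j)) = (\<Sum>j\<le>l. u j * coeff_matrix n l i j)"
      if "i \<le> l" for u i
      unfolding atMost_atLeast0
      by (intro sum.cong refl) (use X_coeff_eq[of l n i _, where 'a = 'a and 'b = 'b] that False assms(2) in auto)
    have p0_sol: "p0 j = ?q ^ (l choose 2) * sol n l j" if "j \<le> l" for j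
      using that by (simp add: p0_def sol_def mult.left_commute)
    have sys: "of_nat (num_anti_invariant n l (T i)) = (\<Sum>j\<le>l. p0 j * coeff_matrix n l i j)"
      if i: "i \<le> l" for i
    proof (cases "i = 0")
      case True
      then show ?thesis
        using alpha_0 by (simp only: sum_first_row)
    next
      case pos: False
      have "num_anti_invariant n l (T i) = 0"
      proof (cases "i = l")
        case True
        then show ?thesis
          using False assms(6) num_anti_invariant_zero_mat[of l n] by simp
      next
        case ne: False
        then show ?thesis
          using T_block(2)[of i] pos i by simp
      qed
      moreover have "(\<Sum>j\<le>l. p0 j * coeff_matrix n l i j) = ?q ^ (l choose 2) * (\<Sum>j\<le>l. sol n l j * coeff_matrix n l i j)"
        by (simp add: p0_sol sum_distrib_left mult.assoc)
      ultimately show ?thesis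
        using sum_sol_zero[of l l i n] pos i assms(2) by simp
    qed
    show ?thesis
    proof
      assume p: "\<forall>i\<le>l. of_nat (num_anti_invariant n l (T i)) = (\<Sum>j=0..l. p j * of_nat (X_coeff TYPE('a) n l i j))"
      have "(\<Sum>j\<le>l. (p j - p0 j) * coeff_matrix n l i j) = 0" if "i \<le> l" for i
        using p sys[OF that] X'[OF that, of p] that by (simp add: left_diff_distrib sum_subtractf)
      then have "p j - p0 j = 0" if "j \<le> l" for j
        using coeff_matrix_nonsingular[of l n "\<lambda>j. p j - p0 j" j] False assms(2) that by simp
      then show "\<forall>j\<le>l. p j = p0 j"
        by simp
    next
      assume "\<forall>j\<le>l. p j = p0 j"
      then have "(\<Sum>j\<le>l. p j * coeff_matrix n l i j) = (\<Sum>j\<le>l. p0 j * coeff_matrix n l i j)" for i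
        by (intro sum.cong) auto
      then show "\<forall>i\<le>l. of_nat (num_anti_invariant n l (T i)) = (\<Sum>j=0..l. p j * of_nat (X_coeff TYPE('a) n l i j))"
        using sys X' by simp
    qed
  qed
  then show ?thesis
    using X p0_eq by simp
qed

end
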